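(* The set $M$ is a ($p$-adic analytic) submanifold of $O_p\times B(1,p^{-1/(p-1)})$. Moreover, if $(x,q)\in M$, then there are a neighborhood $N$ of $x$ in $O_p$ and an analytic function $Q$ on $N$ (with values in $B(1,p^{-1/(p-1)})$) such that $q=Q(x)$ and $(x',Q(x'))\in M$ for all $x'\in N$.
   Context: Let $p$ be a prime, $\mathbb{C}_p$ the $p$-adic complex numbers with absolute value $|\cdot|$ and additive valuation $v$, $|x|=p^{-v(x)}$, $v(p)=1$. Let $O_p=\{x\in\mathbb{C}_p:|x|\le 1\}$ and $B(a,r)=\{b\in\mathbb{C}_p:|b-a|<r\}$. For $x\in O_p$ and $q\in B(1,p^{-1/(p-1)})$ put $q^x=\exp(x\log q)$ ($p$-adic $\exp$ and $\log$), and define the $q$-bracket by $[x]_q=\frac{q^x-1}{q-1}$ if $q\ne 1$ and $[x]_1=x$. The equation $[x]_q=x$ has the trivial solutions $q=1$, $x=0$, $x=1$. To remove them, let $g(X,Q)=\frac{[X]_Q-X}{(Q-1)X(X-1)}$, understood as the analytic function on $O_p\times B(1,p^{-1/(p-1)})$ given by the convergent series $g(X,Q)=\sum_{n\ge 0}\frac{A_n(X)}{(n+2)!}(Q-1)^n$, where $A_0(X)=1$ and $A_n(X)=(X-2)(X-3)\cdots(X-(n+1))$ for $n>0$. Define $M=\{(x,q)\in O_p\times B(1,p^{-1/(p-1)}): g(x,q)=0\}$ (the set of nontrivial fixed points). *)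

theory Defs
  imports "HOL-Analysis.Analysis" "HOL-Computational_Algebra.Computational_Algebra"
begin

text \<open>
  The field \<open>\<complex>\<^sub>p\<close> is specified, up to isometric isomorphism, as the completion of an algebraic
  closure of \<open>\<rat>\<^sub>p\<close>: a complete non-archimedean valued field of characteristic 0 with
  \<open>\<bar>p\<bar> = 1/p\<close>, in which the closure of the rationals (a copy of \<open>\<rat>\<^sub>p\<close>) has an algebraic closure,
  and that algebraic closure is dense. Completeness is the type class \<^class>\<open>complete_space\<close>; the
  metric is the one induced by the absolute value, so that the library's balls, open sets and
  infinite sums are the \<open>p\<close>-adic ones.
\<close>

definition alg_over :: "'a::field set \<Rightarrow> 'a set" where
  "alg_over F = {z. \<exists>f. f \<noteq> 0 \<and> (\<forall>i. coeff f i \<in> F) \<and> poly f z = 0}"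

locale padic_complex_field =
  fixes p :: nat
    and vabs :: "'a::{field_char_0, complete_space} \<Rightarrow> real"
  assumes prime_p: "prime p"
    and dist_vabs: "dist x y = vabs (x - y)"
    and vabs_mult: "vabs (x * y) = vabs x * vabs y"
    and vabs_ultrametric: "vabs (x + y) \<le> max (vabs x) (vabs y)"
    and vabs_p: "vabs (of_nat p) = 1 / real p"
    and Qp_roots: "\<lbrakk>degree f > 0; \<And>i. coeff f i \<in> closure (\<rat> :: 'a set)\<rbrakk> \<Longrightarrow> \<exists>z. poly f z = 0"
    and Qp_alg_dense: "closure (alg_over (closure (\<rat> :: 'a set))) = UNIV"

definition Op :: "'a::{field, metric_space} set" where
  "Op = cball 0 1"

definition Bq :: "nat \<Rightarrow> 'a::{field, metric_space} set" where
  "Bq p = ball 1 (real p powr (- 1 / (real p - 1)))"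

definition A_coeff :: "nat \<Rightarrow> 'a::field \<Rightarrow> 'a" where
  "A_coeff n x = (\<Prod>k = 2..n + 1. x - of_nat k)"

text \<open>
  For \<open>q \<noteq> 1\<close> and \<open>x \<notin> {0, 1}\<close> the following is \<open>([x]\<^sub>q - x) / ((q - 1) x (x - 1))\<close>, by the
  binomial series of \<open>q\<^sup>x\<close>; the series also gives the values on the excluded lines.
\<close>

definition g_fun :: "'a::{field_char_0, metric_space} \<Rightarrow> 'a \<Rightarrow> 'a" where
  "g_fun x q = (\<Sum>n. A_coeff n x / fact (n + 2) * (q - 1) ^ n)"

definition M_set :: "nat \<Rightarrow> ('a::{field_char_0, metric_space} \<times> 'a) set" where
  "M_set p = {(x, q). x \<in> Op \<and> q \<in> Bq p \<and> g_fun x q = 0}"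

text \<open>
  Analyticity on an open set is local expansion in a convergent power series. In two variables
  the double series is summed unconditionally, which over a complete non-archimedean field just
  says that its terms tend to 0 along the cofinite filter.
\<close>

definition padic_analytic_on :: "('a::{field, metric_space} \<Rightarrow> 'a) \<Rightarrow> 'a set \<Rightarrow> bool" where
  "padic_analytic_on f U \<longleftrightarrow>
     (\<forall>a\<in>U. \<exists>r>0. \<exists>c. ball a r \<subseteq> U \<and>
        (\<forall>x\<in>ball a r. (\<lambda>n. c n * (x - a) ^ n) sums f x))"

definition padic_analytic2_on ::
    "('a::{field, metric_space} \<times> 'a \<Rightarrow> 'a) \<Rightarrow> ('a \<times> 'a) set \<Rightarrow> bool" where
  "padic_analytic2_on f U \<longleftrightarrow>
     (\<forall>(a, b)\<in>U. \<exists>r>0. \<exists>c. ball a r \<times> ball b r \<subseteq> U \<and>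
        (\<forall>x\<in>ball a r. \<forall>y\<in>ball b r.
           ((\<lambda>(i, j). c i j * (x - a) ^ i * (y - b) ^ j) has_sum f (x, y)) (UNIV :: (nat \<times> nat) set)))"

definition padic_analytic_map_on ::
    "('a::{field, metric_space} \<times> 'a \<Rightarrow> 'a \<times> 'a) \<Rightarrow> ('a \<times> 'a) set \<Rightarrow> bool" where
  "padic_analytic_map_on F U \<longleftrightarrow>
     padic_analytic2_on (fst \<circ> F) U \<and> padic_analytic2_on (snd \<circ> F) U"

text \<open>The standard \<open>d\<close>-dimensional coordinate subspace of the plane.\<close>

definition coord_subspace :: "nat \<Rightarrow> ('a::zero \<times> 'a) set" where
  "coord_subspace d = {(y, z). (d < 1 \<longrightarrow> y = 0) \<and> (d < 2 \<longrightarrow> z = 0)}"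

text \<open>
  Submanifolds of an open subset \<open>W\<close> of the plane: around each point some analytic chart of \<open>W\<close>
  (a bijection onto an open set, analytic in both directions) flattens \<open>S\<close> to a coordinate subspace.
\<close>

definition padic_submanifold ::
    "('a::{field, metric_space} \<times> 'a) set \<Rightarrow> ('a \<times> 'a) set \<Rightarrow> bool" where
  "padic_submanifold S W \<longleftrightarrow>
     S \<subseteq> W \<and>
     (\<exists>d\<le>2. \<forall>a\<in>S. \<exists>U V \<phi> \<psi>.
        open U \<and> a \<in> U \<and> U \<subseteq> W \<and> open V \<and>
        \<phi> ` U = V \<and> \<psi> ` V = U \<and>
        (\<forall>u\<in>U. \<psi> (\<phi> u) = u) \<and> (\<forall>v\<in>V. \<phi> (\<psi> v) = v) \<and>
        padic_analytic_map_on \<phi> U \<and> padic_analytic_map_on \<psi> V \<and>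
        \<phi> ` (S \<inter> U) = coord_subspace d \<inter> V)"

end

theory Submission
  imports Defs
begin

text \<open>
  Write \<open>u = q - 1\<close> and \<open>g(x, 1 + u) = \<Sum>\<^sub>n c\<^sub>n(x) u\<^sup>n\<close>, where \<open>c\<^sub>n(x) = A\<^sub>n(x) / (n + 2)!\<close>. The whole
  proposition rests on the fact that \<open>\<partial>g/\<partial>u\<close> vanishes nowhere on \<open>M\<close>, which comes from a
  differential equation for \<open>g\<close> that holds uniformly in \<open>x\<close>, also for \<open>x = 0\<close> and \<open>x = 1\<close>: by
  \<open>(n + 3) c\<^sub>n\<^sub>+\<^sub>1(x) = (x - n - 2) c\<^sub>n(x)\<close> and \<open>c\<^sub>0 = 1/2\<close> the series satisfies the linear differential
  equation \<open>(1 + u) (2 g + u \<partial>g/\<partial>u) = x u g + 1\<close>, so that \<open>u (1 + u) \<partial>g/\<partial>u = 1\<close> wherever \<open>g = 0\<close>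
  (lemma \<open>g_fun_deriv_at_zero\<close>).

  The estimate \<open>\<bar>n!\<bar> \<ge> \<rho>\<^sup>n\<close> with \<open>\<rho> = p powr (- 1 / (p - 1))\<close> (lemma \<open>vabs_fact_ge\<close>) makes \<open>g\<close> a
  power series in \<open>u\<close> converging for \<open>\<bar>u\<bar> < \<rho>\<close>, whose coefficients are power series in \<open>x\<close> with
  bounds of order \<open>\<rho>\<^sup>-\<^sup>n\<close>. An implicit function theorem for such series (theorem
  \<open>implicit_function_powser\<close>) then shows that near each of its points \<open>M\<close> is the graph of a power
  series \<open>Q\<close>. It is proved by the simplified Newton iteration \<open>t \<mapsto> t - F(s, t) / d\<close>, carried out on
  functions of \<open>s\<close> that are power series on a fixed ball and are normed by a bound for their
  coefficients; one contraction estimate gives the existence of the solution, its analyticity, and,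
  applied to constant functions, its uniqueness.

  Since \<open>Q\<close> has to be expanded around every point of the ball and not only around its centre, the
  theorem is applied again at each point of the graph, and uniqueness identifies the two solutions
  (lemma \<open>M_set_locally_analytic_graph\<close>). Finally the graph of \<open>Q\<close> is flattened by the shear
  \<open>(x, y) \<mapsto> (x, y - Q x)\<close>, whose inverse is a shear too, so that \<open>M\<close> is a submanifold of dimension 1
  (lemma \<open>padic_submanifold_if_locally_graph\<close>).
\<close>

section \<open>Fields with an ultrametric absolute value\<close>

text \<open>
  The topology enters only through the absolute value, so the laws for limits and series below are
  derived from the ultrametric inequality.
\<close>

locale ultrametric_field =
  fixes vabs :: "'a::{field_char_0, complete_space} \<Rightarrow> real"
  assumes dist_vabs: "dist x y = vabs (x - y)"
    and vabs_mult: "vabs (x * y) = vabs x * vabs y"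
    and vabs_ultrametric: "vabs (x + y) \<le> max (vabs x) (vabs y)"
begin

lemma vabs_conv_dist: "vabs x = dist x 0"
  by (simp add: dist_vabs)

lemma vabs_nonneg [simp]: "0 \<le> vabs x"
  by (simp add: vabs_conv_dist)

lemma vabs_eq_0 [simp]: "vabs x = 0 \<longleftrightarrow> x = 0"
  by (simp add: vabs_conv_dist)

lemma vabs_pos [simp]: "0 < vabs x \<longleftrightarrow> x \<noteq> 0"
  by (simp add: vabs_conv_dist)

lemma vabs_zero [simp]: "vabs 0 = 0"
  by simp

lemma vabs_minus_commute: "vabs (x - y) = vabs (y - x)"
  by (metis dist_commute dist_vabs)

lemma vabs_minus [simp]: "vabs (- x) = vabs x"
  using vabs_minus_commute[of 0 x] by simp

lemma vabs_one [simp]: "vabs 1 = 1"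
proof -
  have "vabs 1 * vabs 1 = vabs 1 * 1"
    using vabs_mult[of 1 1] by simp
  moreover have "vabs 1 \<noteq> 0"
    by (subst vabs_eq_0) simp
  ultimately show ?thesis
    using mult_left_cancel by blast
qed

lemma vabs_power: "vabs (x ^ n) = vabs x ^ n"
  by (induction n) (simp_all add: vabs_mult)

lemma vabs_prod: "vabs (prod f A) = (\<Prod>x\<in>A. vabs (f x))"
  by (induction A rule: infinite_finite_induct) (simp_all add: vabs_mult)

lemma vabs_divide: "vabs (x / y) = vabs x / vabs y"
proof (cases "y = 0")
  case False
  then have "vabs (x / y) * vabs y = vabs x"
    by (simp flip: vabs_mult)
  with False show ?thesis
    by (simp add: field_simps)
qed simp

lemma vabs_add_le: "vabs x \<le> C \<Longrightarrow> vabs y \<le> C \<Longrightarrow> vabs (x + y) \<le> C"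
  using vabs_ultrametric[of x y] by linarith

lemma vabs_diff_le: "vabs x \<le> C \<Longrightarrow> vabs y \<le> C \<Longrightarrow> vabs (x - y) \<le> C"
  using vabs_add_le[of x C "- y"] by simp

lemma vabs_add_less: "vabs x < C \<Longrightarrow> vabs y < C \<Longrightarrow> vabs (x + y) < C"
  using vabs_ultrametric[of x y] by linarith

lemma vabs_diff_less: "vabs x < C \<Longrightarrow> vabs y < C \<Longrightarrow> vabs (x - y) < C"
  using vabs_add_less[of x C "- y"] by simp

lemma vabs_sum_le:
  assumes "0 \<le> C" and "\<And>i. i \<in> A \<Longrightarrow> vabs (f i) \<le> C"
  shows "vabs (sum f A) \<le> C"
  using assms(2)
  by (induction A rule: infinite_finite_induct) (auto simp: assms(1) intro: vabs_add_le)

lemma vabs_of_nat_le: "vabs (of_nat n) \<le> 1"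
  by (induction n) (auto intro: vabs_add_le)

lemma vabs_of_int_le: "vabs (of_int n) \<le> 1"
  by (cases n rule: int_cases2) (simp_all add: vabs_of_nat_le)

lemma mem_ball_vabs: "x \<in> ball a r \<longleftrightarrow> vabs (x - a) < r"
  by (metis dist_commute dist_vabs mem_ball)

lemma mem_cball_vabs: "x \<in> cball a r \<longleftrightarrow> vabs (x - a) \<le> r"
  by (metis dist_commute dist_vabs mem_cball)

lemma ball_recenter:
  fixes a b :: 'a
  assumes "b \<in> ball a r" and "s \<le> r"
  shows "ball b s \<subseteq> ball a r"
proof
  fix x assume "x \<in> ball b s"
  then have "vabs (x - b) < r" "vabs (b - a) < r"
    using assms unfolding mem_ball_vabs by auto
  from vabs_add_less[OF this] show "x \<in> ball a r"
    unfolding mem_ball_vabs by simp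
qed

lemma tendsto_vabs_iff:
  fixes X :: "_ \<Rightarrow> 'a"
  shows "(X \<longlongrightarrow> L) F \<longleftrightarrow> ((\<lambda>n. vabs (X n - L)) \<longlongrightarrow> 0) F"
  by (subst tendsto_dist_iff) (simp add: dist_vabs)

lemma tendsto_vabs_bound:
  fixes X :: "_ \<Rightarrow> 'a"
  assumes "\<And>n. vabs (X n - L) \<le> B n" and "(B \<longlongrightarrow> 0) F"
  shows "(X \<longlongrightarrow> L) F"
  unfolding tendsto_vabs_iff
  by (rule tendsto_sandwich[OF _ _ tendsto_const assms(2)]) (simp_all add: assms(1))

lemma tendsto_add_vabs:
  fixes X Y :: "_ \<Rightarrow> 'a"
  assumes "(X \<longlongrightarrow> L) F" "(Y \<longlongrightarrow> M) F"
  shows "((\<lambda>n. X n + Y n) \<longlongrightarrow> L + M) F"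
proof (rule tendsto_vabs_bound)
  have "((\<lambda>n. vabs (X n - L) + vabs (Y n - M)) \<longlongrightarrow> 0 + 0) F"
    using assms unfolding tendsto_vabs_iff by (rule tendsto_add)
  then show "((\<lambda>n. vabs (X n - L) + vabs (Y n - M)) \<longlongrightarrow> 0) F"
    by simp
  show "vabs (X n + Y n - (L + M)) \<le> vabs (X n - L) + vabs (Y n - M)" for n
  proof -
    have "vabs (X n + Y n - (L + M)) \<le> max (vabs (X n - L)) (vabs (Y n - M))"
      using vabs_ultrametric[of "X n - L" "Y n - M"] by (simp add: algebra_simps)
    then show ?thesis
      using vabs_nonneg[of "X n - L"] vabs_nonneg[of "Y n - M"] by linarith
  qed
qed

lemma tendsto_cmult_vabs:
  fixes X :: "_ \<Rightarrow> 'a"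
  assumes "(X \<longlongrightarrow> L) F"
  shows "((\<lambda>n. c * X n) \<longlongrightarrow> c * L) F"
proof (rule tendsto_vabs_bound)
  have "((\<lambda>n. vabs c * vabs (X n - L)) \<longlongrightarrow> vabs c * 0) F"
    using assms unfolding tendsto_vabs_iff by (intro tendsto_mult tendsto_const)
  then show "((\<lambda>n. vabs c * vabs (X n - L)) \<longlongrightarrow> 0) F"
    by simp
  show "vabs (c * X n - c * L) \<le> vabs c * vabs (X n - L)" for n
    by (simp flip: vabs_mult add: algebra_simps)
qed

lemma tendsto_mult_vabs:
  fixes X Y :: "_ \<Rightarrow> 'a"
  assumes "(X \<longlongrightarrow> L) F" "(Y \<longlongrightarrow> M) F"
  shows "((\<lambda>n. X n * Y n) \<longlongrightarrow> L * M) F"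
proof -
  have "((\<lambda>n. (X n - L) * (Y n - M)) \<longlongrightarrow> 0) F"
  proof (rule tendsto_vabs_bound)
    have "((\<lambda>n. vabs (X n - L) * vabs (Y n - M)) \<longlongrightarrow> 0 * 0) F"
      using assms unfolding tendsto_vabs_iff by (rule tendsto_mult)
    then show "((\<lambda>n. vabs (X n - L) * vabs (Y n - M)) \<longlongrightarrow> 0) F"
      by simp
  qed (simp add: vabs_mult)
  from tendsto_add_vabs[OF this tendsto_add_vabs[OF tendsto_cmult_vabs[OF assms(2), of L]
        tendsto_add_vabs[OF tendsto_cmult_vabs[OF assms(1), of M] tendsto_const[of "- (L * M)"]]]]
  show ?thesis
    by (simp add: algebra_simps)
qed

lemma vabs_limit_le:
  assumes "X \<longlonglongrightarrow> L" and "\<And>n. vabs (X n) \<le> C"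
  shows "vabs L \<le> C"
proof (rule field_le_epsilon)
  fix e :: real assume "0 < e"
  then obtain n where n: "dist (X n) L < e"
    using metric_LIMSEQ_D[OF assms(1)] by blast
  have "vabs L \<le> max (vabs (L - X n)) (vabs (X n))"
    using vabs_ultrametric[of "L - X n" "X n"] by simp
  moreover have "vabs (L - X n) < e"
    using n by (simp add: dist_vabs vabs_minus_commute)
  ultimately show "vabs L \<le> C + e"
    using assms(2)[of n] vabs_nonneg[of "X n"] \<open>0 < e\<close> by linarith
qed

lemma sums_add_vabs:
  fixes f g :: "nat \<Rightarrow> 'a"
  shows "f sums s \<Longrightarrow> g sums t \<Longrightarrow> (\<lambda>n. f n + g n) sums (s + t)"
  unfolding sums_def sum.distrib by (rule tendsto_add_vabs)

lemma sums_cmult_vabs: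
  fixes f :: "nat \<Rightarrow> 'a"
  shows "f sums s \<Longrightarrow> (\<lambda>n. c * f n) sums (c * s)"
  unfolding sums_def sum_distrib_left[symmetric] by (rule tendsto_cmult_vabs)

lemma sums_diff_vabs:
  fixes f g :: "nat \<Rightarrow> 'a"
  shows "f sums s \<Longrightarrow> g sums t \<Longrightarrow> (\<lambda>n. f n - g n) sums (s - t)"
  using sums_add_vabs[of f s "\<lambda>n. - 1 * g n" "- 1 * t"] sums_cmult_vabs[of g t "- 1"] by simp

lemma sums_Suc_vabs:
  fixes f :: "nat \<Rightarrow> 'a"
  assumes "(\<lambda>n. f (Suc n)) sums s"
  shows "f sums (f 0 + s)"
proof -
  have "(\<lambda>n. f 0 + (\<Sum>i<n. f (Suc i))) \<longlonglongrightarrow> f 0 + s"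
    using assms unfolding sums_def by (intro tendsto_add_vabs tendsto_const)
  then have "(\<lambda>n. \<Sum>i<Suc n. f i) \<longlonglongrightarrow> f 0 + s"
    by (simp only: sum.lessThan_Suc_shift)
  then show ?thesis
    unfolding sums_def by (rule LIMSEQ_imp_Suc)
qed

lemma vabs_sums_le:
  assumes "f sums s" and "\<And>n. vabs (f n) \<le> C"
  shows "vabs s \<le> C"
proof (rule vabs_limit_le)
  show "(\<lambda>n. \<Sum>i<n. f i) \<longlonglongrightarrow> s"
    using assms(1) by (simp add: sums_def)
  show "vabs (\<Sum>i<n. f i) \<le> C" for n
    using assms(2) vabs_nonneg order_trans by (blast intro: vabs_sum_le)
qed

text \<open>
  In an ultrametric field the terms of a series need only tend to 0, since the difference of two
  partial sums is bounded by the largest term between them.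
\<close>

lemma summable_if_tendsto_0:
  fixes f :: "nat \<Rightarrow> 'a"
  assumes "f \<longlonglongrightarrow> 0"
  shows "summable f"
proof -
  have "Cauchy (\<lambda>n. \<Sum>i<n. f i)"
  proof (rule metric_CauchyI)
    fix e :: real assume "0 < e"
    then obtain N where N: "\<And>n. n \<ge> N \<Longrightarrow> vabs (f n) < e / 2"
      using metric_LIMSEQ_D[OF assms, of "e / 2"] by (auto simp: dist_vabs)
    have *: "dist (\<Sum>i<n. f i) (\<Sum>i<N. f i) < e" if "n \<ge> N" for n
    proof -
      have "(\<Sum>i<n. f i) - (\<Sum>i<N. f i) = (\<Sum>i\<in>{N..<n}. f i)"
        using that by (metis atLeast0LessThan sum_diff_nat_ivl zero_le)
      also have "vabs \<dots> \<le> e / 2"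
        using N \<open>0 < e\<close> by (intro vabs_sum_le) (auto intro: less_imp_le)
      finally show ?thesis
        using \<open>0 < e\<close> by (simp add: dist_vabs)
    qed
    have "dist (\<Sum>i<m. f i) (\<Sum>i<n. f i) < e" if "m \<ge> N" "n \<ge> N" for m n
    proof -
      have "vabs (((\<Sum>i<m. f i) - (\<Sum>i<N. f i)) - ((\<Sum>i<n. f i) - (\<Sum>i<N. f i))) < e"
        using *[OF that(1)] *[OF that(2)] unfolding dist_vabs by (rule vabs_diff_less)
      then show ?thesis
        by (simp add: dist_vabs)
    qed
    then show "\<exists>M. \<forall>m\<ge>M. \<forall>n\<ge>M. dist (\<Sum>i<m. f i) (\<Sum>i<n. f i) < e"
      by blast
  qed
  then show ?thesis
    by (simp add: summable_iff_convergent Cauchy_convergent)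
qed

lemma summable_if_vabs_le:
  assumes "\<And>n. vabs (f n) \<le> C n" and "C \<longlonglongrightarrow> 0"
  shows "summable f"
  by (rule summable_if_tendsto_0, rule tendsto_vabs_bound[OF _ assms(2)]) (simp add: assms(1))

lemma tendsto_0_if_sums:
  fixes f :: "nat \<Rightarrow> 'a"
  assumes "f sums s"
  shows "f \<longlonglongrightarrow> 0"
proof -
  have "(\<lambda>n. (\<Sum>i<Suc n. f i) + - 1 * (\<Sum>i<n. f i)) \<longlonglongrightarrow> s + - 1 * s"
    using assms unfolding sums_def
    by (intro tendsto_add_vabs tendsto_cmult_vabs LIMSEQ_Suc)
  then show ?thesis
    by simp
qed

text \<open>
  The bound \<open>C k\<close> is uniform along the row \<open>k\<close> and tends to 0. Hence all rows beyond some \<open>K\<close>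
  contribute at most \<open>e / 2\<close> to any finite set of column sums at once, and the finitely many
  remaining rows converge.
\<close>

lemma sums_swap:
  assumes bound: "\<And>k n. vabs (A k n) \<le> C k" and C: "C \<longlonglongrightarrow> 0"
    and rows: "\<And>k. A k sums G k" and cols: "\<And>n. (\<lambda>k. A k n) sums F n" and tot: "G sums S"
  shows "F sums S"
  unfolding sums_def
proof (rule metric_LIMSEQ_I)
  fix e :: real assume e: "0 < e"
  obtain K1 where K1: "\<And>k. k \<ge> K1 \<Longrightarrow> C k < e / 2"
    using order_tendstoD(2)[OF C, of "e / 2"] e by (auto simp: eventually_sequentially)
  obtain K2 where K2: "\<And>k. k \<ge> K2 \<Longrightarrow> vabs ((\<Sum>i<k. G i) - S) < e"
    using metric_LIMSEQ_D[OF tot[unfolded sums_def] e] by (auto simp: dist_vabs)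
  define K where "K = max K1 K2"
  have tail: "vabs (F n - (\<Sum>k<K. A k n)) \<le> e / 2" for n
  proof -
    have "(\<lambda>m. \<Sum>k<m + K. A k n) \<longlonglongrightarrow> F n"
      using cols unfolding sums_def by (rule LIMSEQ_ignore_initial_segment)
    then have "(\<lambda>m. (\<Sum>k<m + K. A k n) + - (\<Sum>k<K. A k n)) \<longlonglongrightarrow> F n + - (\<Sum>k<K. A k n)"
      by (intro tendsto_add_vabs tendsto_const)
    moreover have "vabs ((\<Sum>k<m + K. A k n) + - (\<Sum>k<K. A k n)) \<le> e / 2" for m
    proof -
      have "(\<Sum>k<m + K. A k n) + - (\<Sum>k<K. A k n) = (\<Sum>k\<in>{K..<m + K}. A k n)"
        by (metis atLeast0LessThan sum_diff_nat_ivl zero_le le_add2 add_uminus_conv_diff)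
      also have "vabs \<dots> \<le> e / 2"
      proof (rule vabs_sum_le)
        show "vabs (A k n) \<le> e / 2" if "k \<in> {K..<m + K}" for k
          using bound[of k n] K1[of k] that by (auto simp: K_def)
      qed (use e in simp)
      finally show ?thesis .
    qed
    ultimately show ?thesis
      using vabs_limit_le by fastforce
  qed
  have "(\<lambda>N. \<Sum>k<L. \<Sum>n<N. A k n) \<longlonglongrightarrow> (\<Sum>k<L. G k)" for L
  proof (induction L)
    case (Suc L)
    then show ?case
      using tendsto_add_vabs[OF Suc rows[of L, unfolded sums_def]] by simp
  qed simp
  from metric_LIMSEQ_D[OF this e, of K]
  obtain N0 where N0: "\<And>N. N \<ge> N0 \<Longrightarrow> vabs ((\<Sum>k<K. \<Sum>n<N. A k n) - (\<Sum>k<K. G k)) < e"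
    by (auto simp: dist_vabs)
  have "dist (\<Sum>n<N. F n) S < e" if "N \<ge> N0" for N
  proof -
    have "vabs (\<Sum>n<N. F n - (\<Sum>k<K. A k n)) \<le> e / 2"
      using tail e by (intro vabs_sum_le) auto
    then have "vabs (\<Sum>n<N. F n - (\<Sum>k<K. A k n)) < e"
      using e by linarith
    moreover have "vabs (((\<Sum>k<K. \<Sum>n<N. A k n) - (\<Sum>k<K. G k)) + ((\<Sum>k<K. G k) - S)) < e"
      using N0[OF that] K2[of K] by (intro vabs_add_less) (auto simp: K_def)
    ultimately have "vabs ((\<Sum>n<N. F n - (\<Sum>k<K. A k n)) +
        (((\<Sum>k<K. \<Sum>n<N. A k n) - (\<Sum>k<K. G k)) + ((\<Sum>k<K. G k) - S))) < e"
      by (rule vabs_add_less)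
    moreover have "(\<Sum>k<K. \<Sum>n<N. A k n) = (\<Sum>n<N. \<Sum>k<K. A k n)"
      by (rule sum.swap)
    ultimately show ?thesis
      by (simp add: dist_vabs sum_subtractf)
  qed
  then show "\<exists>N0. \<forall>N\<ge>N0. dist (\<Sum>n<N. F n) S < e"
    by blast
qed

text \<open>
  The product of two partial sums of length \<open>N\<close> differs from the \<open>N\<close>th partial sum of the Cauchy
  product by terms of total index at least \<open>N\<close>, each of which is at most \<open>C D \<theta>\<^sup>N\<close>.
\<close>

lemma Cauchy_product_sums_vabs:
  assumes x: "x sums X" and y: "y sums Y"
    and xb: "\<And>i. vabs (x i) \<le> C * \<theta> ^ i" and yb: "\<And>i. vabs (y i) \<le> D * \<theta> ^ i"
    and \<theta>: "0 \<le> \<theta>" "\<theta> < 1"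
  shows "(\<lambda>k. \<Sum>i\<le>k. x i * y (k - i)) sums (X * Y)"
proof -
  let ?P = "\<lambda>N. (\<Sum>i<N. x i) * (\<Sum>i<N. y i)"
  let ?S = "\<lambda>N. \<Sum>k<N. \<Sum>i\<le>k. x i * y (k - i)"
  have CD: "0 \<le> C" "0 \<le> D"
    using xb[of 0] yb[of 0] vabs_nonneg[of "x 0"] vabs_nonneg[of "y 0"]
    by (simp_all add: order_trans[OF vabs_nonneg])
  have "vabs ((?S N - ?P N) - 0) \<le> C * D * \<theta> ^ N" for N
  proof -
    let ?B = "{(i, j). i < N \<and> j < N}" and ?T = "{(i, j). i + j < N}"
    have fin: "finite ?B"
      by (rule finite_subset[of _ "{..<N} \<times> {..<N}"]) auto
    have "?P N = (\<Sum>(i, j)\<in>?B. x i * y j)"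
      unfolding sum_product sum.cartesian_product by (rule sum.cong) auto
    moreover have "?S N = (\<Sum>(i, j)\<in>?T. x i * y j)"
      by (rule sum.triangle_reindex[symmetric])
    moreover have "(\<Sum>(i, j)\<in>?B. x i * y j) = (\<Sum>(i, j)\<in>?B - ?T. x i * y j) + (\<Sum>(i, j)\<in>?T. x i * y j)"
      by (rule sum.subset_diff[OF _ fin]) auto
    ultimately have "?S N - ?P N = - (\<Sum>(i, j)\<in>?B - ?T. x i * y j)"
      by simp
    also have "vabs \<dots> \<le> C * D * \<theta> ^ N"
      unfolding vabs_minus
    proof (rule vabs_sum_le)
      fix q assume "q \<in> ?B - ?T"
      then obtain i j where q: "q = (i, j)" "N \<le> i + j"
        by force
      have "vabs (x i) * vabs (y j) \<le> (C * \<theta> ^ i) * (D * \<theta> ^ j)"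
        using CD \<theta> by (intro mult_mono xb yb) auto
      also have "\<dots> = C * D * \<theta> ^ (i + j)"
        by (simp add: power_add)
      also have "\<dots> \<le> C * D * \<theta> ^ N"
        using CD \<theta> q by (intro mult_left_mono power_decreasing) auto
      finally show "vabs (case q of (i, j) \<Rightarrow> x i * y j) \<le> C * D * \<theta> ^ N"
        by (simp add: q vabs_mult)
    qed (use CD \<theta> in auto)
    finally show ?thesis by simp
  qed
  moreover have "(\<lambda>N. C * D * \<theta> ^ N) \<longlonglongrightarrow> 0"
    using \<theta> LIMSEQ_realpow_zero by (intro tendsto_mult_right_zero) auto
  ultimately have "(\<lambda>N. ?S N - ?P N) \<longlonglongrightarrow> 0"
    by (rule tendsto_vabs_bound)
  from tendsto_add_vabs[OF this tendsto_mult_vabs[OF x[unfolded sums_def] y[unfolded sums_def]]]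
  show ?thesis
    by (simp add: sums_def)
qed

section \<open>Power series with bounded coefficients\<close>

text \<open>
  This is a ball of radius \<open>C\<close> in the Banach algebra of bounded power series on the open disc of
  radius \<open>r\<close>, where the coefficient \<open>c\<^sub>n\<close> has weight \<open>r\<^sup>n\<close>. Attaching the bound to functions, and not
  to coefficient sequences, makes the algebra pointwise.
\<close>

definition powser_bdd :: "real \<Rightarrow> real \<Rightarrow> ('a \<Rightarrow> 'a) \<Rightarrow> bool" where
  "powser_bdd r C f \<longleftrightarrow>
     (\<exists>c. (\<forall>n. vabs (c n) * r ^ n \<le> C) \<and> (\<forall>s. vabs s < r \<longrightarrow> (\<lambda>n. c n * s ^ n) sums f s))"

lemma powser_bddI:
  assumes "\<And>n. vabs (c n) * r ^ n \<le> C"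
    and "\<And>s. vabs s < r \<Longrightarrow> (\<lambda>n. c n * s ^ n) sums f s"
  shows "powser_bdd r C f"
  unfolding powser_bdd_def by (rule exI[of _ c]) (simp add: assms)

lemma powser_bddE:
  assumes "powser_bdd r C f"
  obtains c where "\<And>n. vabs (c n) * r ^ n \<le> C"
    and "\<And>s. vabs s < r \<Longrightarrow> (\<lambda>n. c n * s ^ n) sums f s"
proof -
  from assms obtain c
    where c: "(\<forall>n. vabs (c n) * r ^ n \<le> C) \<and> (\<forall>s. vabs s < r \<longrightarrow> (\<lambda>n. c n * s ^ n) sums f s)"
    unfolding powser_bdd_def by (rule exE)
  show ?thesis
    by (rule that[of c]) (simp_all add: c)
qed

lemma powser_term_le:
  assumes "vabs c * r ^ n \<le> C" and "vabs s < r"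
  shows "vabs (c * s ^ n) \<le> C * (vabs s / r) ^ n"
proof -
  have r: "0 < r"
    using assms(2) vabs_nonneg[of s] by linarith
  have "vabs (c * s ^ n) = (vabs c * r ^ n) * (vabs s / r) ^ n"
    using r by (simp add: vabs_mult vabs_power power_divide)
  also have "\<dots> \<le> C * (vabs s / r) ^ n"
    using assms r by (intro mult_right_mono) auto
  finally show ?thesis .
qed

lemma powser_bdd_nonneg:
  assumes "powser_bdd r C f"
  shows "0 \<le> C"
proof -
  obtain c where "\<And>n. vabs (c n) * r ^ n \<le> C"
    by (rule powser_bddE[OF assms]) (rule that)
  from this[of 0] show ?thesis
    using order_trans[OF vabs_nonneg] by simp
qed

lemma powser_bdd_value_le:
  assumes "powser_bdd r C f" and s: "vabs s < r"
  shows "vabs (f s) \<le> C"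
proof -
  obtain c where c: "\<And>n. vabs (c n) * r ^ n \<le> C"
    and f: "\<And>s. vabs s < r \<Longrightarrow> (\<lambda>n. c n * s ^ n) sums f s"
    by (rule powser_bddE[OF assms(1)]) (rule that)
  have "vabs (c n * s ^ n) \<le> C" for n
  proof -
    have "vabs (c n * s ^ n) = vabs (c n) * vabs s ^ n"
      by (simp add: vabs_mult vabs_power)
    also have "\<dots> \<le> vabs (c n) * r ^ n"
      using s by (intro mult_left_mono power_mono) auto
    finally show ?thesis
      using c[of n] by linarith
  qed
  with f[OF s] show ?thesis
    by (rule vabs_sums_le)
qed

lemma powser_bdd_mono: "powser_bdd r C f \<Longrightarrow> C \<le> D \<Longrightarrow> powser_bdd r D f"
  by (erule powser_bddE, rule powser_bddI) (blast intro: order_trans)+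

lemma powser_bdd_const:
  assumes "vabs a \<le> C"
  shows "powser_bdd r C (\<lambda>_. a)"
proof (rule powser_bddI)
  let ?c = "\<lambda>n::nat. if n = 0 then a else 0"
  have "0 \<le> C"
    using assms vabs_nonneg[of a] by linarith
  then show "vabs (?c n) * r ^ n \<le> C" for n
    using assms by auto
  show "(\<lambda>n. ?c n * s ^ n) sums a" for s
    using sums_single[of 0 "\<lambda>_. a"] by (rule sums_cong[THEN iffD1, rotated]) auto
qed

lemma powser_bdd_id:
  assumes "0 \<le> r"
  shows "powser_bdd r r (\<lambda>s. s)"
proof (rule powser_bddI)
  let ?c = "\<lambda>n::nat. if n = 1 then 1 else 0 :: 'a"
  show "vabs (?c n) * r ^ n \<le> r" for n
    using assms by auto
  show "(\<lambda>n. ?c n * s ^ n) sums s" for s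
    using sums_single[of 1 "\<lambda>_. s"] by (rule sums_cong[THEN iffD1, rotated]) auto
qed

lemma powser_bdd_add:
  assumes r: "0 \<le> r" and "powser_bdd r C f" "powser_bdd r C g"
  shows "powser_bdd r C (\<lambda>s. f s + g s)"
proof -
  obtain c where c: "\<And>n. vabs (c n) * r ^ n \<le> C" "\<And>s. vabs s < r \<Longrightarrow> (\<lambda>n. c n * s ^ n) sums f s"
    by (rule powser_bddE[OF assms(2)]) (rule that)
  obtain d where d: "\<And>n. vabs (d n) * r ^ n \<le> C" "\<And>s. vabs s < r \<Longrightarrow> (\<lambda>n. d n * s ^ n) sums g s"
    by (rule powser_bddE[OF assms(3)]) (rule that)
  show ?thesis
  proof (rule powser_bddI)
    fix n
    have "vabs (c n + d n) * r ^ n \<le> max (vabs (c n)) (vabs (d n)) * r ^ n"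
      using r by (intro mult_right_mono vabs_ultrametric) auto
    then show "vabs (c n + d n) * r ^ n \<le> C"
      using c(1)[of n] d(1)[of n] by (auto simp: max_def split: if_splits)
  next
    fix s assume "vabs s < r"
    then show "(\<lambda>n. (c n + d n) * s ^ n) sums (f s + g s)"
      unfolding distrib_right by (intro sums_add_vabs c d)
  qed
qed

lemma powser_bdd_mult:
  assumes "powser_bdd r C f" "powser_bdd r D g"
  shows "powser_bdd r (C * D) (\<lambda>s. f s * g s)"
proof -
  have CD: "0 \<le> C" "0 \<le> D"
    using assms by (simp_all add: powser_bdd_nonneg)
  obtain c where c: "\<And>n. vabs (c n) * r ^ n \<le> C" "\<And>s. vabs s < r \<Longrightarrow> (\<lambda>n. c n * s ^ n) sums f s"
    by (rule powser_bddE[OF assms(1)]) (rule that)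
  obtain d where d: "\<And>n. vabs (d n) * r ^ n \<le> D" "\<And>s. vabs s < r \<Longrightarrow> (\<lambda>n. d n * s ^ n) sums g s"
    by (rule powser_bddE[OF assms(2)]) (rule that)
  show ?thesis
  proof (cases "0 < r")
    case False
    then have "\<not> vabs s < r" for s
      using vabs_nonneg[of s] by linarith
    then show ?thesis
      using CD by (intro powser_bddI[where c = "\<lambda>_. 0"]) auto
  next
    case r: True
    let ?e = "\<lambda>n. \<Sum>i\<le>n. c i * d (n - i)"
    show ?thesis
    proof (rule powser_bddI)
      fix n
      have "vabs (?e n) \<le> C * D / r ^ n"
      proof (rule vabs_sum_le)
        fix i assume "i \<in> {..n}"
        then have "vabs (c i * d (n - i)) * r ^ n = (vabs (c i) * r ^ i) * (vabs (d (n - i)) * r ^ (n - i))"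
          by (simp add: vabs_mult flip: power_add)
        also have "\<dots> \<le> C * D"
          using CD r by (intro mult_mono c d) auto
        finally show "vabs (c i * d (n - i)) \<le> C * D / r ^ n"
          using r by (simp add: field_simps)
      qed (use CD r in auto)
      then show "vabs (?e n) * r ^ n \<le> C * D"
        using r by (simp add: field_simps)
    next
      fix s assume s: "vabs s < r"
      have "(\<lambda>k. \<Sum>i\<le>k. (c i * s ^ i) * (d (k - i) * s ^ (k - i))) sums (f s * g s)"
        by (rule Cauchy_product_sums_vabs[OF c(2)[OF s] d(2)[OF s] powser_term_le[OF c(1) s]
              powser_term_le[OF d(1) s]]) (use s r in auto)
      moreover have "(\<Sum>i\<le>k. (c i * s ^ i) * (d (k - i) * s ^ (k - i))) = ?e k * s ^ k" for k
        unfolding sum_distrib_right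
      proof (rule sum.cong)
        fix i assume "i \<in> {..k}"
        then have "s ^ k = s ^ i * s ^ (k - i)"
          by (simp flip: power_add)
        then show "(c i * s ^ i) * (d (k - i) * s ^ (k - i)) = c i * d (k - i) * s ^ k"
          by (simp add: mult_ac)
      qed simp
      ultimately show "(\<lambda>n. ?e n * s ^ n) sums (f s * g s)"
        by simp
    qed
  qed
qed

lemma powser_bdd_cmult:
  assumes "powser_bdd r C f" and "vabs a * C \<le> D"
  shows "powser_bdd r D (\<lambda>s. a * f s)"
  using powser_bdd_mono[OF powser_bdd_mult[OF powser_bdd_const[OF order_refl] assms(1)] assms(2)] .

lemma powser_bdd_power:
  assumes "powser_bdd r C f"
  shows "powser_bdd r (C ^ n) (\<lambda>s. f s ^ n)"
proof (induction n)
  case (Suc n)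
  then show ?case
    using powser_bdd_mult[OF assms] by simp
qed (simp add: powser_bdd_const)

text \<open>
  Subtracting the constant term gains a factor \<open>r\<close>, because every remaining term carries at least one
  factor \<open>s\<close>. This is what makes the dependence on \<open>s\<close> negligible on a small disc.
\<close>

lemma powser_bdd_restrict:
  assumes "powser_bdd 1 C f" and r: "0 < r" "r \<le> 1"
  shows "powser_bdd r C f" and "powser_bdd r (r * C) (\<lambda>s. f s - f 0)"
proof -
  have C: "0 \<le> C"
    using assms(1) by (rule powser_bdd_nonneg)
  obtain c where c': "\<And>n. vabs (c n) * 1 ^ n \<le> C" and f: "\<And>s. vabs s < 1 \<Longrightarrow> (\<lambda>n. c n * s ^ n) sums f s"
    by (rule powser_bddE[OF assms(1)]) (rule that)
  have c: "vabs (c n) \<le> C" for n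
    using c'[of n] by simp
  have "vabs (c n) * r ^ n \<le> C * 1" for n
    using r C c by (intro mult_mono power_le_one) auto
  then show "powser_bdd r C f"
    using f r by (intro powser_bddI[of c]) auto
  have "(\<lambda>n. if n = 0 then c 0 else 0) sums f 0"
    using f[of 0] by (rule sums_cong[THEN iffD1, rotated]) auto
  moreover have "(\<lambda>n. if n = 0 then c 0 else 0) sums c 0"
    by (rule sums_single)
  ultimately have f0: "f 0 = c 0"
    by (rule sums_unique2)
  show "powser_bdd r (r * C) (\<lambda>s. f s - f 0)"
  proof (rule powser_bddI)
    let ?d = "\<lambda>n. if n = 0 then 0 else c n"
    fix n
    have "vabs (c n) * r ^ n \<le> C * r ^ 1" if "n > 0"
      using that r C c by (intro mult_mono power_decreasing) auto
    then show "vabs (?d n) * r ^ n \<le> r * C"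
      using r C by (auto simp: mult.commute)
  next
    fix s assume "vabs s < r"
    then have "(\<lambda>n. c n * s ^ n) sums f s"
      using r by (intro f) auto
    from sums_diff_vabs[OF this sums_single[of 0 "\<lambda>_. c 0"]]
    show "(\<lambda>n. (if n = 0 then 0 else c n) * s ^ n) sums (f s - f 0)"
      unfolding f0 by (rule sums_cong[THEN iffD1, rotated]) auto
  qed
qed

text \<open>
  The completeness of the algebra, in the form in which it is used: the coefficients of the sum are the
  sums of the coefficients, by the exchange of summation.
\<close>

lemma powser_bdd_sums:
  assumes r: "0 < r" and f: "\<And>k. powser_bdd r (C k) (f k)"
    and C: "C \<longlonglongrightarrow> 0" "\<And>k. C k \<le> D"
    and F: "\<And>s. vabs s < r \<Longrightarrow> (\<lambda>k. f k s) sums F s"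
  shows "powser_bdd r D F"
proof -
  have "\<exists>c. (\<forall>n. vabs (c n) * r ^ n \<le> C k) \<and> (\<forall>s. vabs s < r \<longrightarrow> (\<lambda>n. c n * s ^ n) sums f k s)" for k
    using f[of k] unfolding powser_bdd_def .
  then obtain c where c: "\<And>k n. vabs (c k n) * r ^ n \<le> C k"
    and fk: "\<And>k s. vabs s < r \<Longrightarrow> (\<lambda>n. c k n * s ^ n) sums f k s"
    by metis
  have cb: "vabs (c k n) \<le> C k * (1 / r ^ n)" for k n
    using c[of k n] r by (simp add: field_simps)
  have sc: "(\<lambda>k. c k n) sums (\<Sum>k. c k n)" for n
    using C(1) by (intro summable_sums summable_if_vabs_le[OF cb] tendsto_mult_left_zero)
  show ?thesis
  proof (rule powser_bddI)
    fix n
    have "vabs (c k n) \<le> D / r ^ n" for k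
      using order_trans[OF c[of k n] C(2)[of k]] r by (simp add: field_simps)
    from vabs_sums_le[OF sc this] show "vabs (\<Sum>k. c k n) * r ^ n \<le> D"
      using r by (simp add: field_simps)
  next
    fix s assume s: "vabs s < r"
    show "(\<lambda>n. (\<Sum>k. c k n) * s ^ n) sums F s"
    proof (rule sums_swap)
      show "vabs (c k n * s ^ n) \<le> C k" for k n
      proof -
        have "vabs (c k n) * vabs s ^ n \<le> vabs (c k n) * r ^ n"
          using s by (intro mult_left_mono power_mono) auto
        then show ?thesis
          using c[of k n] by (simp add: vabs_mult vabs_power)
      qed
      show "(\<lambda>k. c k n * s ^ n) sums ((\<Sum>k. c k n) * s ^ n)" for n
        using sums_cmult_vabs[OF sc, of "s ^ n"] by (simp add: mult.commute)
    qed (use C fk[OF s] F[OF s] in auto)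
  qed
qed

text \<open>
  First-order Taylor expansion of \<open>v \<mapsto> v\<^sup>n\<close>: replacing \<open>x\<^sup>n - y\<^sup>n\<close> by its linearisation at \<open>u\<close> costs
  a factor \<open>\<delta>\<close> relative to the size \<open>E\<close> of \<open>x - y\<close>, without a factor \<open>n\<close>, as integers have absolute
  value at most 1. The induction splits \<open>x\<^sup>n\<^sup>+\<^sup>1 - y\<^sup>n\<^sup>+\<^sup>1 - (n + 1) u\<^sup>n (x - y)\<close> into
  \<open>x\<close> times the previous remainder, \<open>n u\<^sup>n\<^sup>-\<^sup>1 (x - u) (x - y)\<close> and \<open>(y\<^sup>n - u\<^sup>n) (x - y)\<close>.
\<close>

lemma powser_bdd_power_diff_linear:
  assumes r: "0 \<le> r" and x: "powser_bdd r R x" "powser_bdd r \<delta> (\<lambda>s. x s - u)"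
    and y: "powser_bdd r R y" "powser_bdd r \<delta> (\<lambda>s. y s - u)"
    and xy: "powser_bdd r E (\<lambda>s. x s - y s)" and R: "0 < R" "vabs u \<le> R"
  shows "powser_bdd r (E * R ^ n / R) (\<lambda>s. x s ^ n - y s ^ n)"
    and "powser_bdd r (\<delta> * E * R ^ n / R\<^sup>2)
           (\<lambda>s. x s ^ n - y s ^ n - of_nat n * u ^ (n - 1) * (x s - y s))"
proof -
  have E: "0 \<le> E" and \<delta>: "0 \<le> \<delta>"
    using xy x by (auto dest: powser_bdd_nonneg)
  have pd: "powser_bdd r (E * R ^ n / R) (\<lambda>s. v s ^ n - w s ^ n)"
    if "powser_bdd r R v" "powser_bdd r R w" "powser_bdd r E (\<lambda>s. v s - w s)" for v w E n
  proof (induction n)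
    case 0
    have "0 \<le> E"
      using that by (auto dest: powser_bdd_nonneg)
    then show ?case
      using R by (simp add: powser_bdd_const)
  next
    case (Suc n)
    have "powser_bdd r (E * R ^ n) (\<lambda>s. v s * (v s ^ n - w s ^ n))"
      using powser_bdd_mult[OF that(1) Suc] R by simp
    from powser_bdd_add[OF r this powser_bdd_mult[OF that(3) powser_bdd_power[OF that(2)]]]
    have "powser_bdd r (E * R ^ n) (\<lambda>s. v s * (v s ^ n - w s ^ n) + (v s - w s) * w s ^ n)" .
    then show ?case
      using R by (simp add: algebra_simps)
  qed
  show "powser_bdd r (E * R ^ n / R) (\<lambda>s. x s ^ n - y s ^ n)"
    by (rule pd[OF x(1) y(1) xy])
  show "powser_bdd r (\<delta> * E * R ^ n / R\<^sup>2)
           (\<lambda>s. x s ^ n - y s ^ n - of_nat n * u ^ (n - 1) * (x s - y s))"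
  proof (induction n)
    case 0
    then show ?case
      using E \<delta> by (simp add: powser_bdd_const)
  next
    case (Suc n)
    define B where "B = \<delta> * E * R ^ n / R"
    have 1: "powser_bdd r B (\<lambda>s. x s * (x s ^ n - y s ^ n - of_nat n * u ^ (n - 1) * (x s - y s)))"
      using powser_bdd_mult[OF x(1) Suc] R by (simp add: B_def power2_eq_square)
    have 2: "powser_bdd r B (\<lambda>s. of_nat n * u ^ (n - 1) * ((x s - u) * (x s - y s)))"
    proof (cases "n = 0")
      case True
      then show ?thesis
        using E \<delta> R by (simp add: B_def powser_bdd_const)
    next
      case False
      have "vabs (of_nat n * u ^ (n - 1)) \<le> 1 * R ^ (n - 1)"
        unfolding vabs_mult vabs_power using R
        by (intro mult_mono power_mono vabs_of_nat_le) auto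
      then have "vabs (of_nat n * u ^ (n - 1)) * (\<delta> * E) \<le> R ^ (n - 1) * (\<delta> * E)"
        using E \<delta> by (intro mult_right_mono) auto
      also have "\<dots> = B"
        using False R by (cases n) (auto simp: B_def)
      finally show ?thesis
        by (rule powser_bdd_cmult[OF powser_bdd_mult[OF x(2) xy]])
    qed
    have 3: "powser_bdd r B (\<lambda>s. (y s ^ n - u ^ n) * (x s - y s))"
      using powser_bdd_mult[OF pd[OF y(1) powser_bdd_const[OF R(2)] y(2), of n] xy]
      by (simp add: B_def mult_ac)
    have eq: "x s * (x s ^ n - y s ^ n - of_nat n * u ^ (n - 1) * (x s - y s)) +
        (of_nat n * u ^ (n - 1) * ((x s - u) * (x s - y s)) + (y s ^ n - u ^ n) * (x s - y s)) =
        x s ^ Suc n - y s ^ Suc n - of_nat (Suc n) * u ^ (Suc n - 1) * (x s - y s)" for s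
      by (cases n) (simp_all add: algebra_simps)
    have "B = \<delta> * E * R ^ Suc n / R\<^sup>2"
      using R by (simp add: B_def power2_eq_square)
    then show ?case
      using powser_bdd_add[OF r 1 powser_bdd_add[OF r 2 3]] unfolding eq by simp
  qed
qed

section \<open>Analytic functions and graphs\<close>

text \<open>
  Outside the first \<open>N\<close> terms every finite partial sum is as small as its largest term, so a convergent
  series converges unconditionally.
\<close>

lemma has_sum_if_sums:
  fixes f :: "nat \<Rightarrow> 'a"
  assumes f: "f sums s"
  shows "(f has_sum s) UNIV"
  unfolding has_sum_def tendsto_iff eventually_finite_subsets_at_top
proof (intro allI impI)
  fix e :: real assume e: "0 < e"
  obtain N1 where N1: "\<And>n. n \<ge> N1 \<Longrightarrow> vabs (f n) < e / 2"
    using metric_LIMSEQ_D[OF tendsto_0_if_sums[OF f], of "e / 2"] e by (auto simp: dist_vabs)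
  obtain N2 where N2: "\<And>n. n \<ge> N2 \<Longrightarrow> vabs ((\<Sum>i<n. f i) - s) < e"
    using metric_LIMSEQ_D[OF f[unfolded sums_def] e] by (auto simp: dist_vabs)
  define N where "N = max N1 N2"
  have "dist (sum f Y) s < e" if Y: "finite Y" "{..<N} \<subseteq> Y" for Y
  proof -
    have "vabs (sum f (Y - {..<N})) \<le> e / 2"
      using e N1 by (intro vabs_sum_le) (auto simp: N_def intro: less_imp_le)
    then have "vabs (sum f (Y - {..<N}) + ((\<Sum>i<N. f i) - s)) < e"
      using e by (intro vabs_add_less N2) (auto simp: N_def)
    then show ?thesis
      using sum.subset_diff[OF Y(2,1), of f] by (simp add: dist_vabs add_diff_eq)
  qed
  then show "\<exists>X. finite X \<and> X \<subseteq> UNIV \<and>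
      (\<forall>Y. finite Y \<and> X \<subseteq> Y \<and> Y \<subseteq> UNIV \<longrightarrow> dist (sum f Y) s < e)"
    by (intro exI[of _ "{..<N}"]) simp
qed

lemma padic_analytic_onE:
  fixes Q :: "'a \<Rightarrow> 'a"
  assumes "padic_analytic_on Q N" and "a \<in> N"
  obtains r c where "0 < r" "ball a r \<subseteq> N" "\<And>x. x \<in> ball a r \<Longrightarrow> (\<lambda>n. c n * (x - a) ^ n) sums Q x"
proof -
  from bspec[OF assms(1)[unfolded padic_analytic_on_def] assms(2)]
  obtain r where r: "0 < r \<and> (\<exists>c. ball a r \<subseteq> N \<and> (\<forall>x\<in>ball a r. (\<lambda>n. c n * (x - a) ^ n) sums Q x))"
    by (rule exE)
  from conjunct2[OF r]
  obtain c where c: "ball a r \<subseteq> N \<and> (\<forall>x\<in>ball a r. (\<lambda>n. c n * (x - a) ^ n) sums Q x)"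
    by (rule exE)
  show thesis
    by (rule that[of r c]) (use r c in auto)
qed

lemma padic_analytic_on_id:
  fixes N :: "'a set"
  assumes "open N"
  shows "padic_analytic_on (\<lambda>x. x) N"
  unfolding padic_analytic_on_def
proof
  fix a assume "a \<in> N"
  then obtain r where r: "0 < r" "ball a r \<subseteq> N"
    using assms by (auto simp: open_contains_ball)
  let ?c = "\<lambda>n::nat. (if n = 0 then a else 0) + (if n = 1 then 1 else 0)"
  have "(\<lambda>n. ?c n * (x - a) ^ n) sums x" for x
  proof -
    have "(\<lambda>n. (if n = 0 then a else 0) + (if n = 1 then x - a else 0)) sums (a + (x - a))"
      by (intro sums_add_vabs sums_single)
    then have "(\<lambda>n. ?c n * (x - a) ^ n) sums (a + (x - a))"
      by (rule sums_cong[THEN iffD1, rotated]) auto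
    then show ?thesis
      by simp
  qed
  with r show "\<exists>r>0. \<exists>c. ball a r \<subseteq> N \<and> (\<forall>x\<in>ball a r. (\<lambda>n. c n * (x - a) ^ n) sums x)"
    by (intro exI[of _ r] conjI exI[of _ ?c]) auto
qed

lemma padic_analytic_on_uminus:
  fixes Q :: "'a \<Rightarrow> 'a"
  assumes "padic_analytic_on Q N"
  shows "padic_analytic_on (\<lambda>x. - Q x) N"
  unfolding padic_analytic_on_def
proof
  fix a assume "a \<in> N"
  then obtain r c where r: "0 < r" "ball a r \<subseteq> N"
    and c: "\<And>x. x \<in> ball a r \<Longrightarrow> (\<lambda>n. c n * (x - a) ^ n) sums Q x"
    by (rule padic_analytic_onE[OF assms]) (rule that)
  have "(\<lambda>n. - c n * (x - a) ^ n) sums (- Q x)" if "x \<in> ball a r" for x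
    using sums_cmult_vabs[OF c[OF that], of "- 1"] by simp
  with r show "\<exists>r>0. \<exists>c. ball a r \<subseteq> N \<and> (\<forall>x\<in>ball a r. (\<lambda>n. c n * (x - a) ^ n) sums (- Q x))"
    by (intro exI[of _ r] conjI exI[of _ "\<lambda>n. - c n"]) auto
qed

lemma padic_analytic2_on_add_linear:
  fixes Q :: "'a \<Rightarrow> 'a"
  assumes Q: "padic_analytic_on Q N" and W: "open W"
  shows "padic_analytic2_on (\<lambda>(x, y). Q x + k * y) (N \<times> W)"
  unfolding padic_analytic2_on_def
proof (intro ballI, unfold split_paired_all, intro case_prodI)
  fix a b assume "(a, b) \<in> N \<times> W"
  then have "a \<in> N" "b \<in> W"
    by auto
  obtain r1 c where r1: "0 < r1" "ball a r1 \<subseteq> N"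
    and c: "\<And>x. x \<in> ball a r1 \<Longrightarrow> (\<lambda>n. c n * (x - a) ^ n) sums Q x"
    by (rule padic_analytic_onE[OF Q \<open>a \<in> N\<close>]) (rule that)
  obtain r2 where r2: "0 < r2" "ball b r2 \<subseteq> W"
    using W \<open>b \<in> W\<close> by (auto simp: open_contains_ball)
  \<comment> \<open>The monomials that occur are \<open>(x - a)\<^sup>i\<close> and \<open>y - b\<close>; \<open>\<iota>\<close> lists their exponents.\<close>
  define d where "d i j = (if j = 0 then c i + (if i = 0 then k * b else 0)
    else if i = 0 \<and> j = 1 then k else 0)" for i j :: nat
  define \<iota> :: "nat \<Rightarrow> nat \<times> nat" where "\<iota> n = (case n of 0 \<Rightarrow> (0, 1) | Suc m \<Rightarrow> (m, 0))" for n
  have inj: "inj \<iota>"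
    by (auto simp: inj_on_def \<iota>_def split: nat.splits)
  have range: "(i, j) \<in> range \<iota>" if "d i j \<noteq> 0" for i j
  proof (cases j)
    case 0
    then have "(i, j) = \<iota> (Suc i)"
      by (simp add: \<iota>_def)
    then show ?thesis
      by (simp only: rangeI)
  next
    case (Suc j')
    with that have "(i, j) = \<iota> 0"
      by (auto simp: \<iota>_def d_def split: if_splits)
    then show ?thesis
      by (simp only: rangeI)
  qed
  have sum: "((\<lambda>(i, j). d i j * (x - a) ^ i * (y - b) ^ j) has_sum (Q x + k * y)) UNIV"
    if x: "x \<in> ball a r1" for x y
  proof -
    let ?h = "\<lambda>(i, j). d i j * (x - a) ^ i * (y - b) ^ j"
    have "(\<lambda>n. c n * (x - a) ^ n + (if n = 0 then k * b else 0)) sums (Q x + k * b)"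
      by (intro sums_add_vabs sums_single c x)
    then have tail: "(\<lambda>n. (?h \<circ> \<iota>) (Suc n)) sums (Q x + k * b)"
      by (rule sums_cong[THEN iffD1, rotated]) (simp add: \<iota>_def d_def distrib_right)
    have "(?h \<circ> \<iota>) 0 = k * (y - b)"
      by (simp add: \<iota>_def d_def)
    with sums_Suc_vabs[of "?h \<circ> \<iota>", OF tail]
    have "(?h \<circ> \<iota>) sums (k * (y - b) + (Q x + k * b))"
      by (simp only:)
    then have "((?h \<circ> \<iota>) has_sum (Q x + k * y)) UNIV"
      by (intro has_sum_if_sums) (simp add: algebra_simps)
    then have "(?h has_sum (Q x + k * y)) (range \<iota>)"
      by (simp only: has_sum_reindex[OF inj])
    then show ?thesis
      by (rule has_sum_cong_neutral[THEN iffD1, rotated -1]) (use range in auto)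
  qed
  have "ball a (min r1 r2) \<times> ball b (min r1 r2) \<subseteq> N \<times> W"
    using r1 r2 by auto
  moreover have "0 < min r1 r2"
    using r1 r2 by simp
  ultimately show "\<exists>r>0. \<exists>c. ball a r \<times> ball b r \<subseteq> N \<times> W \<and>
      (\<forall>x\<in>ball a r. \<forall>y\<in>ball b r.
        ((\<lambda>(i, j). c i j * (x - a) ^ i * (y - b) ^ j) has_sum (case (x, y) of (x, y) \<Rightarrow> Q x + k * y)) UNIV)"
    using sum by (intro exI[of _ "min r1 r2"] conjI exI[of _ d]) auto
qed

text \<open>
  The shear \<open>\<phi> (x, y) = (x, y - Q x)\<close> straightens the graph of \<open>Q\<close>, with inverse
  \<open>\<psi> (x, y) = (x, y + Q x)\<close>. It maps the box \<open>ball a r \<times> ball b \<delta>\<close> onto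
  \<open>ball a r \<times> ball 0 \<delta>\<close>, since by the ultrametric inequality any value of \<open>Q\<close> is a centre of
  \<open>ball b \<delta>\<close>.
\<close>

lemma padic_submanifold_if_locally_graph:
  fixes S W :: "('a \<times> 'a) set"
  assumes "S \<subseteq> W"
    and graph: "\<And>a b. (a, b) \<in> S \<Longrightarrow> \<exists>r \<delta> Q. 0 < r \<and> 0 < \<delta> \<and> ball a r \<times> ball b \<delta> \<subseteq> W \<and>
      padic_analytic_on Q (ball a r) \<and> Q ` ball a r \<subseteq> ball b \<delta> \<and>
      (\<forall>x\<in>ball a r. \<forall>y\<in>ball b \<delta>. (x, y) \<in> S \<longleftrightarrow> y = Q x)"
  shows "padic_submanifold S W"
  unfolding padic_submanifold_def
proof (intro conjI exI[of _ 1] ballI)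
  fix z assume "z \<in> S"
  obtain a b where z: "z = (a, b)"
    by (cases z)
  from graph[OF \<open>z \<in> S\<close>[unfolded z]] obtain r \<delta> Q where *: "0 < r \<and> 0 < \<delta> \<and> ball a r \<times> ball b \<delta> \<subseteq> W \<and>
      padic_analytic_on Q (ball a r) \<and> Q ` ball a r \<subseteq> ball b \<delta> \<and>
      (\<forall>x\<in>ball a r. \<forall>y\<in>ball b \<delta>. (x, y) \<in> S \<longleftrightarrow> y = Q x)"
    by (elim exE)
  then have r: "0 < r" and \<delta>: "0 < \<delta>" and W: "ball a r \<times> ball b \<delta> \<subseteq> W"
    and Q: "padic_analytic_on Q (ball a r)"
    by blast+
  from * have Q_mem: "\<And>x. x \<in> ball a r \<Longrightarrow> Q x \<in> ball b \<delta>"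
    and S: "\<And>x y. x \<in> ball a r \<Longrightarrow> y \<in> ball b \<delta> \<Longrightarrow> (x, y) \<in> S \<longleftrightarrow> y = Q x"
    by blast+
  define \<phi> where "\<phi> = (\<lambda>(x, y). (x, y - Q x))"
  define \<psi> where "\<psi> = (\<lambda>(x, y). (x, y + Q x))"
  let ?U = "ball a r \<times> ball b \<delta>" and ?V = "ball a r \<times> ball 0 \<delta>"
  have inverse: "\<psi> (\<phi> u) = u" "\<phi> (\<psi> u) = u" for u
    by (auto simp: \<phi>_def \<psi>_def split: prod.splits)
  have \<phi>_mem: "\<phi> u \<in> ?V" if "u \<in> ?U" for u
  proof -
    from that obtain x y where u: "u = (x, y)" "x \<in> ball a r" "y \<in> ball b \<delta>"
      by (rule SigmaE)
    have "vabs ((y - b) - (Q x - b)) < \<delta>"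
      using u(3) Q_mem[OF u(2)] unfolding mem_ball_vabs by (rule vabs_diff_less)
    then have "y - Q x \<in> ball 0 \<delta>"
      unfolding mem_ball_vabs by simp
    with u show ?thesis
      by (simp add: \<phi>_def)
  qed
  have \<psi>_mem: "\<psi> v \<in> ?U" if "v \<in> ?V" for v
  proof -
    from that obtain x y where v: "v = (x, y)" "x \<in> ball a r" "y \<in> ball 0 \<delta>"
      by (rule SigmaE)
    have "vabs ((y - 0) + (Q x - b)) < \<delta>"
      using v(3) Q_mem[OF v(2)] unfolding mem_ball_vabs by (rule vabs_add_less)
    then have "y + Q x \<in> ball b \<delta>"
      unfolding mem_ball_vabs by (simp add: add_diff_eq)
    with v show ?thesis
      by (simp add: \<psi>_def)
  qed
  have image: "\<phi> ` ?U = ?V" "\<psi> ` ?V = ?U"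
  proof -
    have V: "v \<in> \<phi> ` ?U" if "v \<in> ?V" for v
      using imageI[OF \<psi>_mem[OF that], of \<phi>] unfolding inverse .
    have U: "u \<in> \<psi> ` ?V" if "u \<in> ?U" for u
      using imageI[OF \<phi>_mem[OF that], of \<psi>] unfolding inverse .
    show "\<phi> ` ?U = ?V"
    proof (rule subset_antisym)
      show "\<phi> ` ?U \<subseteq> ?V"
        using \<phi>_mem by (rule image_subsetI)
      show "?V \<subseteq> \<phi> ` ?U"
        using V by (rule subsetI)
    qed
    show "\<psi> ` ?V = ?U"
    proof (rule subset_antisym)
      show "\<psi> ` ?V \<subseteq> ?U"
        using \<psi>_mem by (rule image_subsetI)
      show "?U \<subseteq> \<psi> ` ?V"
        using U by (rule subsetI)
    qed
  qed
  have fst: "padic_analytic2_on (\<lambda>(x, y). x + 0 * y) (ball a r \<times> ball c \<delta>)" for c :: 'a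
    by (intro padic_analytic2_on_add_linear padic_analytic_on_id) auto
  have analytic: "padic_analytic_map_on \<phi> ?U" "padic_analytic_map_on \<psi> ?V"
    using fst padic_analytic2_on_add_linear[OF padic_analytic_on_uminus[OF Q], of "ball b \<delta>" 1]
      padic_analytic2_on_add_linear[OF Q, of "ball 0 \<delta>" 1]
    by (simp_all add: padic_analytic_map_on_def \<phi>_def \<psi>_def comp_def case_prod_unfold add.commute)
  have flat: "\<phi> u \<in> coord_subspace 1 \<longleftrightarrow> u \<in> S" if "u \<in> ?U" for u
  proof -
    from that obtain x y where u: "u = (x, y)" "x \<in> ball a r" "y \<in> ball b \<delta>"
      by (rule SigmaE)
    show ?thesis
      unfolding u(1) S[OF u(2,3)] by (simp add: \<phi>_def coord_subspace_def)
  qed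
  have "f ` (S \<inter> A) = C \<inter> f ` A" if "\<And>u. u \<in> A \<Longrightarrow> f u \<in> C \<longleftrightarrow> u \<in> S"
    for f :: "'a \<times> 'a \<Rightarrow> 'a \<times> 'a" and A C
    using that by blast
  from this[of ?U, OF flat] have "\<phi> ` (S \<inter> ?U) = coord_subspace 1 \<inter> ?V"
    unfolding image(1) .
  moreover have "z \<in> ?U"
    using r \<delta> by (simp add: z)
  ultimately show "\<exists>U V \<phi> \<psi>. open U \<and> z \<in> U \<and> U \<subseteq> W \<and> open V \<and>
      \<phi> ` U = V \<and> \<psi> ` V = U \<and>
      (\<forall>u\<in>U. \<psi> (\<phi> u) = u) \<and> (\<forall>v\<in>V. \<phi> (\<psi> v) = v) \<and>
      padic_analytic_map_on \<phi> U \<and> padic_analytic_map_on \<psi> V \<and>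
      \<phi> ` (S \<inter> U) = coord_subspace 1 \<inter> V"
    using W image inverse analytic
    by (intro exI[of _ ?U] exI[of _ ?V] exI[of _ \<phi>] exI[of _ \<psi>]) (simp add: open_Times)
qed (use assms(1) in auto)

section \<open>The implicit function theorem\<close>

text \<open>
  For \<open>F(s, u) = \<Sum>\<^sub>n P\<^sub>n(s) u\<^sup>n\<close> with \<open>F(0, u0) = 0\<close> and \<open>d = \<partial>F/\<partial>u(0, u0) \<noteq> 0\<close> the solution \<open>x(s)\<close> of
  \<open>F(s, x(s)) = 0\<close> is the limit of the iteration \<open>x \<mapsto> x - F(s, x) / d\<close> starting at \<open>u0\<close>. On functions
  within \<open>\<delta>\<close> of \<open>u0\<close> the difference \<open>F(s, x) - F(s, y)\<close> is \<open>d (x - y)\<close> up to an error of at most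
  \<open>\<bar>d\<bar> / 2\<close> times the size of \<open>x - y\<close>, so that the steps shrink by 1/2 in the norm of bounded power series. Here
  \<open>r\<close> and \<open>\<delta>\<close> can be taken below any \<open>\<eta>\<close>, which lets solutions at different centres be compared.
\<close>

theorem implicit_function_powser:
  assumes P: "\<And>n. powser_bdd 1 (K / \<rho> ^ n) (P n)" and u0: "vabs u0 < \<rho>"
    and zero: "(\<lambda>n. P n 0 * u0 ^ n) sums 0"
    and deriv: "(\<lambda>n. of_nat n * P n 0 * u0 ^ (n - 1)) sums d" and d: "d \<noteq> 0"
    and \<eta>: "0 < \<eta>"
  obtains r \<delta> c x where "0 < r" "r \<le> \<eta>" "0 < \<delta>" "\<delta> \<le> \<eta>"
    and "\<And>s. vabs s < r \<Longrightarrow> (\<lambda>n. c n * s ^ n) sums x s"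
    and "\<And>s. vabs s < r \<Longrightarrow> vabs (x s - u0) < \<delta>"
    and "\<And>s u. vabs s < r \<Longrightarrow> vabs (u - u0) < \<delta> \<Longrightarrow> (\<lambda>n. P n s * u ^ n) sums 0 \<longleftrightarrow> u = x s"
proof -
  have K: "0 \<le> K"
    using powser_bdd_nonneg[OF P[of 0]] by simp
  have vd: "0 < vabs d"
    using d by simp
  have \<rho>: "0 < \<rho>"
    using u0 vabs_nonneg[of u0] by linarith
  define R where "R = (vabs u0 + \<rho>) / 2"
  have R: "0 < R" "R < \<rho>" "vabs u0 < R"
    using u0 add_nonneg_pos[OF vabs_nonneg \<rho>, of u0] by (simp_all add: R_def)
  define \<theta> where "\<theta> = R / \<rho>"
  have \<theta>: "0 \<le> \<theta>" "\<theta> < 1"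
    using R \<rho> by (auto simp: \<theta>_def)
  have \<theta>n: "\<theta> ^ n \<le> 1" for n
    using \<theta> by (intro power_le_one) auto
  have \<theta>_lim: "(\<lambda>n. C * \<theta> ^ n) \<longlonglongrightarrow> 0" for C
    using \<theta> by (intro tendsto_mult_right_zero LIMSEQ_realpow_zero) auto
  define K1 where "K1 = K * (1 / R + 1 / R\<^sup>2) + 1"
  have "0 \<le> K * (1 / R)" "0 \<le> K * (1 / R\<^sup>2)"
    using K R by auto
  then have K1: "0 < K1" "K / R \<le> K1" "K / R\<^sup>2 \<le> K1"
    by (auto simp: K1_def distrib_left)
  \<comment> \<open>The ball of radius \<open>\<delta>\<close> is small enough for the Newton step to contract by 1/2, and then \<open>r\<close>
     small enough for the first step to stay within \<open>\<delta> / 2\<close>.\<close>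
  define \<delta> where "\<delta> = min (min \<eta> R) (vabs d / (2 * K1))"
  have \<delta>: "0 < \<delta>" "\<delta> \<le> \<eta>" "\<delta> \<le> R" "K1 * \<delta> \<le> vabs d / 2"
  proof -
    show "0 < \<delta>" "\<delta> \<le> \<eta>" "\<delta> \<le> R"
      using \<eta> R vd K1 by (auto simp: \<delta>_def)
    have "K1 * \<delta> \<le> K1 * (vabs d / (2 * K1))"
      using K1 by (intro mult_left_mono) (auto simp: \<delta>_def)
    then show "K1 * \<delta> \<le> vabs d / 2"
      using K1 by simp
  qed
  define r where "r = min (min \<delta> 1) (vabs d * \<delta> / (2 * (K + 1)))"
  have r: "0 < r" "r \<le> \<delta>" "r \<le> 1" "r * K \<le> vabs d * (\<delta> / 2)"
  proof -
    show r0: "0 < r" and "r \<le> \<delta>" "r \<le> 1"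
      using \<delta> vd K by (auto simp: r_def)
    have "r * K \<le> r * (K + 1)"
      using r0 by simp
    also have "\<dots> \<le> (vabs d * \<delta> / (2 * (K + 1))) * (K + 1)"
      using K by (intro mult_right_mono) (auto simp: r_def)
    also have "\<dots> = vabs d * (\<delta> / 2)"
      using K by (simp add: field_simps add_nonneg_eq_0_iff)
    finally show "r * K \<le> vabs d * (\<delta> / 2)" .
  qed
  have P_le: "vabs (P n s) \<le> K / \<rho> ^ n" if "vabs s < r" for n s
    using that r by (intro powser_bdd_value_le[OF P]) auto
  have P0_le: "vabs (P n 0) \<le> K / \<rho> ^ n" for n
    using P_le[of 0] r by simp
  define F where "F s u = (\<Sum>n. P n s * u ^ n)" for s u
  have F: "(\<lambda>n. P n s * u ^ n) sums F s u" if "vabs s < r" "vabs u \<le> R" for s u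
    unfolding F_def
  proof (rule summable_sums, rule summable_if_vabs_le[OF _ \<theta>_lim[of K]])
    fix n
    have "vabs (P n s * u ^ n) \<le> (K / \<rho> ^ n) * R ^ n"
      unfolding vabs_mult vabs_power using P_le[OF that(1)] that(2) K \<rho>
      by (intro mult_mono power_mono) auto
    then show "vabs (P n s * u ^ n) \<le> K * \<theta> ^ n"
      by (simp add: \<theta>_def power_divide)
  qed
  have near_le: "vabs u \<le> R" if "vabs (u - u0) \<le> \<delta>" for u
    using vabs_add_le[of "u - u0" R u0] that \<delta> R by simp
  have contraction: "powser_bdd r (vabs d / 2 * E) (\<lambda>s. F s (x s) - F s (y s) - d * (x s - y s))"
    if x: "powser_bdd r \<delta> (\<lambda>s. x s - u0)" and y: "powser_bdd r \<delta> (\<lambda>s. y s - u0)"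
      and xy: "powser_bdd r E (\<lambda>s. x s - y s)" for x y E
  proof (rule powser_bdd_sums)
    let ?l = "\<lambda>n s. x s ^ n - y s ^ n - of_nat n * u0 ^ (n - 1) * (x s - y s)"
    let ?f = "\<lambda>n s. (P n s - P n 0) * (x s ^ n - y s ^ n) + P n 0 * ?l n s"
    let ?C = "\<lambda>n. K1 * \<delta> * E * \<theta> ^ n"
    have E: "0 \<le> E"
      using xy by (rule powser_bdd_nonneg)
    have bdd_R: "powser_bdd r R z" if "powser_bdd r \<delta> (\<lambda>s. z s - u0)" for z
      using powser_bdd_add[OF _ powser_bdd_mono[OF that \<delta>(3)] powser_bdd_const[of u0 R]] r R by simp
    note lin = powser_bdd_power_diff_linear[OF _ bdd_R[OF x] x bdd_R[OF y] y xy]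
    \<comment> \<open>The first summand is small because \<open>P\<^sub>n\<close> is nearly constant, the second by Taylor expansion.\<close>
    show "powser_bdd r (?C n) (?f n)" for n
    proof (rule powser_bdd_add)
      have "powser_bdd r (r * (K / \<rho> ^ n) * (E * R ^ n / R)) (\<lambda>s. (P n s - P n 0) * (x s ^ n - y s ^ n))"
        using r R by (intro powser_bdd_mult powser_bdd_restrict[OF P] lin) auto
      moreover have "r * (K / \<rho> ^ n) * (E * R ^ n / R) = r * (K / R) * (E * \<theta> ^ n)"
        by (simp add: \<theta>_def power_divide)
      moreover have "r * (K / R) * (E * \<theta> ^ n) \<le> \<delta> * K1 * (E * \<theta> ^ n)"
        using r \<delta> K K1 R E \<theta> by (intro mult_right_mono mult_mono) auto
      ultimately show "powser_bdd r (?C n) (\<lambda>s. (P n s - P n 0) * (x s ^ n - y s ^ n))"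
        by (elim powser_bdd_mono) (simp add: mult_ac)
      have "powser_bdd r (\<delta> * E * R ^ n / R\<^sup>2) (?l n)"
        using r R by (intro lin) auto
      moreover have "vabs (P n 0) * (\<delta> * E * R ^ n / R\<^sup>2) \<le> ?C n"
      proof -
        have "vabs (P n 0) * (\<delta> * E * R ^ n / R\<^sup>2) \<le> (K / \<rho> ^ n) * (\<delta> * E * R ^ n / R\<^sup>2)"
          using \<delta> E R by (intro mult_right_mono P0_le) auto
        also have "\<dots> = (K / R\<^sup>2) * (\<delta> * E * \<theta> ^ n)"
          by (simp add: \<theta>_def power_divide)
        also have "\<dots> \<le> K1 * (\<delta> * E * \<theta> ^ n)"
          using K1 \<delta> E \<theta> by (intro mult_right_mono) auto
        finally show ?thesis
          by (simp add: mult_ac)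
      qed
      ultimately show "powser_bdd r (?C n) (\<lambda>s. P n 0 * ?l n s)"
        by (rule powser_bdd_cmult)
    qed (use r in simp)
    show "?C \<longlonglongrightarrow> 0"
      by (rule \<theta>_lim)
    show "?C n \<le> vabs d / 2 * E" for n
    proof -
      have "?C n \<le> (K1 * \<delta>) * E * 1"
        using K1 \<delta> E \<theta>n by (intro mult_left_mono) auto
      also have "\<dots> \<le> vabs d / 2 * E"
        using mult_right_mono[OF \<delta>(4) E] by simp
      finally show ?thesis .
    qed
    fix s assume s: "vabs s < r"
    have "vabs (x s) \<le> R" "vabs (y s) \<le> R"
      using s by (auto intro: near_le powser_bdd_value_le[OF x] powser_bdd_value_le[OF y])
    from sums_diff_vabs[OF sums_diff_vabs[OF F[OF s this(1)] F[OF s this(2)]]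
        sums_cmult_vabs[OF deriv, of "x s - y s"]]
    show "(\<lambda>n. ?f n s) sums (F s (x s) - F s (y s) - d * (x s - y s))"
      unfolding mult.commute[of d] by (rule sums_cong[THEN iffD1, rotated]) (simp add: algebra_simps)
  qed (rule r)
  \<comment> \<open>As \<open>F(0, u0) = 0\<close>, the coefficients may be replaced by \<open>P\<^sub>n(s) - P\<^sub>n(0)\<close>, which are of size \<open>r\<close>.\<close>
  have start: "powser_bdd r (\<delta> / 2) (\<lambda>s. (- 1 / d) * F s u0)"
  proof (rule powser_bdd_cmult)
    show "powser_bdd r (vabs d * (\<delta> / 2)) (\<lambda>s. F s u0)"
    proof (rule powser_bdd_sums)
      show "powser_bdd r (r * K * \<theta> ^ n) (\<lambda>s. u0 ^ n * (P n s - P n 0))" for n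
      proof (rule powser_bdd_cmult)
        show "powser_bdd r (r * (K / \<rho> ^ n)) (\<lambda>s. P n s - P n 0)"
          using r by (intro powser_bdd_restrict[OF P])
        have "vabs (u0 ^ n) * (r * (K / \<rho> ^ n)) \<le> R ^ n * (r * (K / \<rho> ^ n))"
          unfolding vabs_power using R r K \<rho> by (intro mult_right_mono power_mono) auto
        then show "vabs (u0 ^ n) * (r * (K / \<rho> ^ n)) \<le> r * K * \<theta> ^ n"
          by (simp add: \<theta>_def power_divide mult_ac)
      qed
      show "r * K * \<theta> ^ n \<le> vabs d * (\<delta> / 2)" for n
      proof -
        have "r * K * \<theta> ^ n \<le> r * K * 1"
          using r K by (intro mult_left_mono \<theta>n mult_nonneg_nonneg) simp_all
        then show ?thesis
          using r(4) by linarith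
      qed
      show "(\<lambda>n. u0 ^ n * (P n s - P n 0)) sums F s u0" if "vabs s < r" for s
        using sums_diff_vabs[OF F[OF that, of u0] zero] R by (simp add: algebra_simps)
    qed (use r \<theta>_lim in auto)
    show "vabs (- 1 / d) * (vabs d * (\<delta> / 2)) \<le> \<delta> / 2"
      using vd by (simp add: vabs_divide)
  qed
  define X where "X k = ((\<lambda>x s. x s + (- 1 / d) * F s (x s)) ^^ k) (\<lambda>_. u0)" for k
  have X_0: "X 0 = (\<lambda>_. u0)" and X_Suc: "X (Suc k) = (\<lambda>s. X k s + (- 1 / d) * F s (X k s))" for k
    by (simp_all add: X_def)
  have X: "powser_bdd r (\<delta> / 2) (\<lambda>s. X k s - u0) \<and>
      powser_bdd r (\<delta> / 2 * (1 / 2) ^ k) (\<lambda>s. X (Suc k) s - X k s)" for k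
  proof (induction k)
    case 0
    then show ?case
      using start \<delta> by (simp add: X_0 X_Suc powser_bdd_const)
  next
    case (Suc k)
    have "\<delta> / 2 * (1 / 2) ^ k \<le> \<delta> / 2"
      using \<delta> by (simp add: power_le_one)
    with Suc have "powser_bdd r (\<delta> / 2) (\<lambda>s. X (Suc k) s - X k s)"
      by (blast intro: powser_bdd_mono)
    with Suc have "powser_bdd r (\<delta> / 2) (\<lambda>s. (X (Suc k) s - X k s) + (X k s - u0))"
      using r by (intro powser_bdd_add) auto
    then have 1: "powser_bdd r (\<delta> / 2) (\<lambda>s. X (Suc k) s - u0)"
      by simp
    have \<delta>2: "\<delta> / 2 \<le> \<delta>"
      using \<delta> by simp
    have "powser_bdd r (vabs d / 2 * (\<delta> / 2 * (1 / 2) ^ k))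
        (\<lambda>s. F s (X (Suc k) s) - F s (X k s) - d * (X (Suc k) s - X k s))"
      by (rule contraction[OF powser_bdd_mono[OF 1 \<delta>2] powser_bdd_mono[OF conjunct1[OF Suc] \<delta>2] conjunct2[OF Suc]])
    then have "powser_bdd r (\<delta> / 2 * (1 / 2) ^ Suc k)
        (\<lambda>s. (- 1 / d) * (F s (X (Suc k) s) - F s (X k s) - d * (X (Suc k) s - X k s)))"
      by (rule powser_bdd_cmult) (use d in \<open>simp add: vabs_divide\<close>)
    moreover have "(- 1 / d) * (F s (X (Suc k) s) - F s (X k s) - d * (X (Suc k) s - X k s)) =
        X (Suc (Suc k)) s - X (Suc k) s" for s
      using d by (simp add: X_Suc field_simps)
    ultimately show ?case
      using 1 by simp
  qed
  have half_lim: "(\<lambda>k. C * (1 / 2) ^ k) \<longlonglongrightarrow> 0" for C :: real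
    by (intro tendsto_mult_right_zero LIMSEQ_realpow_zero) auto
  define x where "x s = u0 + (\<Sum>k. X (Suc k) s - X k s)" for s
  have step_le: "vabs (X (Suc k) s - X k s) \<le> \<delta> / 2 * (1 / 2) ^ k" if "vabs s < r" for k s
    using X[of k] that by (auto dest: powser_bdd_value_le)
  have x_sums: "(\<lambda>k. X (Suc k) s - X k s) sums (x s - u0)" if "vabs s < r" for s
    using summable_sums[OF summable_if_vabs_le[OF step_le[OF that] half_lim]] by (simp add: x_def)
  have x_bdd: "powser_bdd r (\<delta> / 2) (\<lambda>s. x s - u0)"
  proof (rule powser_bdd_sums)
    show "powser_bdd r (\<delta> / 2 * (1 / 2) ^ k) (\<lambda>s. X (Suc k) s - X k s)" for k
      using X by blast
    show "\<delta> / 2 * (1 / 2) ^ k \<le> \<delta> / 2" for k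
      using \<delta> by (simp add: power_le_one)
    show "(\<lambda>k. \<delta> / 2 * (1 / 2) ^ k) \<longlonglongrightarrow> 0"
      by (rule half_lim)
  qed (use r x_sums in auto)
  have x_near: "vabs (x s - u0) < \<delta>" if "vabs s < r" for s
    using powser_bdd_value_le[OF x_bdd that] \<delta> by linarith
  have X_lim: "(\<lambda>k. X k s) \<longlonglongrightarrow> x s" if "vabs s < r" for s
  proof -
    have "(\<lambda>k. u0 + (\<Sum>i<k. X (Suc i) s - X i s)) \<longlonglongrightarrow> u0 + (x s - u0)"
      using x_sums[OF that] unfolding sums_def by (intro tendsto_add_vabs tendsto_const)
    then show ?thesis
      by (simp add: sum_lessThan_telescope[of "\<lambda>k. X k s"] X_0)
  qed
  \<comment> \<open>The contraction estimate for constant functions is an estimate at single points.\<close>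
  have close: "vabs (F s u - F s v - d * (u - v)) \<le> vabs d / 2 * vabs (u - v)"
    if "vabs s < r" "vabs (u - u0) \<le> \<delta>" "vabs (v - u0) \<le> \<delta>" for s u v
    using contraction[of "\<lambda>_. u" "\<lambda>_. v" "vabs (u - v)"] that
    by (auto simp: powser_bdd_const dest: powser_bdd_value_le)
  have lipschitz: "vabs (F s u - F s v) \<le> vabs d * vabs (u - v)"
    if "vabs s < r" "vabs (u - u0) \<le> \<delta>" "vabs (v - u0) \<le> \<delta>" for s u v
  proof -
    have "vabs (F s u - F s v - d * (u - v)) \<le> vabs d * vabs (u - v)"
      using close[OF that] mult_nonneg_nonneg[OF vabs_nonneg[of d] vabs_nonneg[of "u - v"]] by linarith
    moreover have "vabs (d * (u - v)) \<le> vabs d * vabs (u - v)"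
      by (simp add: vabs_mult)
    ultimately have "vabs ((F s u - F s v - d * (u - v)) + d * (u - v)) \<le> vabs d * vabs (u - v)"
      by (rule vabs_add_le)
    then show ?thesis
      by simp
  qed
  have F_x: "F s (x s) = 0" if s: "vabs s < r" for s
  proof -
    have "(\<lambda>k. F s (X k s)) \<longlonglongrightarrow> F s (x s)"
    proof (rule tendsto_vabs_bound)
      have "vabs (X k s - u0) \<le> \<delta>" for k
        using powser_bdd_value_le[OF conjunct1[OF X[of k]] s] \<delta> by linarith
      then show "vabs (F s (X k s) - F s (x s)) \<le> vabs d * vabs (X k s - x s)" for k
        using x_near[OF s] by (intro lipschitz s) auto
      show "(\<lambda>k. vabs d * vabs (X k s - x s)) \<longlonglongrightarrow> 0"
        using X_lim[OF s] unfolding tendsto_vabs_iff by (rule tendsto_mult_right_zero)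
    qed
    moreover have "(\<lambda>k. F s (X k s)) \<longlonglongrightarrow> 0"
    proof (rule tendsto_vabs_bound[OF _ half_lim])
      fix k
      have "F s (X k s) = - d * (X (Suc k) s - X k s)"
        using d by (simp add: X_Suc)
      then have "vabs (F s (X k s)) = vabs d * vabs (X (Suc k) s - X k s)"
        by (simp only: vabs_mult vabs_minus)
      also have "\<dots> \<le> vabs d * (\<delta> / 2 * (1 / 2) ^ k)"
        by (intro mult_left_mono step_le s) simp
      finally show "vabs (F s (X k s) - 0) \<le> (vabs d * (\<delta> / 2)) * (1 / 2) ^ k"
        by simp
    qed
    ultimately show ?thesis
      by (rule LIMSEQ_unique)
  qed
  have zero_iff: "(\<lambda>n. P n s * u ^ n) sums 0 \<longleftrightarrow> u = x s" if "vabs s < r" "vabs (u - u0) < \<delta>" for s u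
  proof -
    note Fu = F[OF that(1) near_le[OF less_imp_le[OF that(2)]]]
    have *: "u = x s" if "F s u = 0"
    proof (rule ccontr)
      assume "u \<noteq> x s"
      then have pos: "0 < vabs d * vabs (u - x s)"
        using d by simp
      have "vabs (F s u - F s (x s) - d * (u - x s)) \<le> vabs d / 2 * vabs (u - x s)"
        using \<open>vabs s < r\<close> \<open>vabs (u - u0) < \<delta>\<close> x_near by (intro close) (auto intro: less_imp_le)
      then show False
        using pos by (simp add: that F_x[OF \<open>vabs s < r\<close>] vabs_mult)
    qed
    show ?thesis
    proof
      assume "(\<lambda>n. P n s * u ^ n) sums 0"
      from sums_unique2[OF Fu this] show "u = x s"
        by (rule *)
    next
      assume "u = x s"
      then have "F s u = 0"
        using F_x[OF that(1)] by simp
      with Fu show "(\<lambda>n. P n s * u ^ n) sums 0"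
        by simp
    qed
  qed
  have "powser_bdd r R (\<lambda>s. (x s - u0) + u0)"
    by (rule powser_bdd_add[OF _ powser_bdd_mono[OF x_bdd] powser_bdd_const]) (use r \<delta> R in auto)
  then have "powser_bdd r R x"
    by simp
  then obtain c where c: "\<And>s. vabs s < r \<Longrightarrow> (\<lambda>n. c n * s ^ n) sums x s"
    by (rule powser_bddE) (rule that)
  show thesis
  proof (rule that[OF _ _ \<delta>(1,2) c x_near zero_iff])
    show "0 < r" "r \<le> \<eta>"
      using r \<delta> by simp_all
  qed
qed

end

section \<open>The absolute value of factorials\<close>

sublocale padic_complex_field \<subseteq> ultrametric_field vabs
  by unfold_locales (rule dist_vabs vabs_mult vabs_ultrametric)+

context padic_complex_field
begin

definition conv_radius_q :: real where
  "conv_radius_q = real p powr (- 1 / (real p - 1))"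

lemma p_gt_1: "1 < real p"
  using prime_gt_1_nat[OF prime_p] by simp

lemma conv_radius_q_pos: "0 < conv_radius_q"
  using p_gt_1 by (simp add: conv_radius_q_def)

lemma conv_radius_q_le_1: "conv_radius_q \<le> 1"
  using p_gt_1 by (simp add: conv_radius_q_def powr_le_one_le powr_minus_divide divide_le_eq_1 ge_one_powr_ge_zero)

lemma conv_radius_q_power: "conv_radius_q ^ (p - 1) = 1 / real p"
proof -
  have "conv_radius_q ^ (p - 1) = real p powr (- 1 / (real p - 1) * real (p - 1))"
    using p_gt_1 by (simp add: conv_radius_q_def powr_realpow[symmetric] powr_powr)
  also have "- 1 / (real p - 1) * real (p - 1) = - 1"
    using p_gt_1 by (simp add: of_nat_diff)
  finally show ?thesis
    using p_gt_1 by (simp add: powr_minus_divide)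
qed

text \<open>
  In a Bezout relation \<open>a p + b n = 1\<close> the first term has absolute value below 1, so the second has
  absolute value at least 1.
\<close>

lemma vabs_of_nat_coprime:
  assumes "\<not> p dvd n"
  shows "vabs (of_nat n) = 1"
proof -
  have "coprime (int p) (int n)"
    using prime_imp_coprime[OF prime_p assms] by simp
  then obtain a b where "a * int p + b * int n = 1"
    using bezout_coefficients_fst_snd[of "int p" "int n"] by auto
  then have eq: "of_int a * of_nat p + of_int b * of_nat n = (1 :: 'a)"
    by (metis of_int_1 of_int_add of_int_mult of_int_of_nat_eq)
  have "vabs (of_int a * of_nat p) \<le> 1 * (1 / real p)"
    unfolding vabs_mult vabs_p by (intro mult_right_mono vabs_of_int_le) auto
  then have "vabs (of_int a * of_nat p) < 1"
    using p_gt_1 by (simp add: order.strict_trans1)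
  then have "1 \<le> vabs (of_int b * of_nat n)"
    using vabs_ultrametric[of "of_int a * of_nat p" "of_int b * of_nat n"] by (simp add: eq)
  also have "\<dots> \<le> 1 * vabs (of_nat n)"
    unfolding vabs_mult by (intro mult_right_mono vabs_of_int_le) auto
  finally show ?thesis
    using vabs_of_nat_le[of n] by simp
qed

text \<open>
  Only the multiples \<open>p, 2p, \<dots>, m p\<close> of \<open>p\<close> with \<open>m = n div p\<close> contribute to \<open>\<bar>n!\<bar>\<close>, which is therefore
  \<open>p\<^sup>-\<^sup>m \<bar>m!\<bar>\<close>. As \<open>1/p\<close> is the \<open>(p - 1)\<close>st power of the radius \<open>\<rho>\<close>, induction gives
  \<open>\<rho>\<^bsup>(p - 1) m + m\<^esup> = \<rho>\<^bsup>p m\<^esup> \<ge> \<rho>\<^sup>n\<close>.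
\<close>

lemma vabs_fact_ge: "conv_radius_q ^ n \<le> vabs (fact n)"
proof (induction n rule: less_induct)
  case (less n)
  show ?case
  proof (cases "n = 0")
    case False
    define m where "m = n div p"
    have p: "1 < p"
      using p_gt_1 by simp
    then have m: "m < n" "p * m \<le> n"
      using False by (auto simp: m_def)
    have multiples: "{k \<in> {1..n}. p dvd k} = (\<lambda>j. p * j) ` {1..m}"
    proof (intro equalityI subsetI)
      fix k assume "k \<in> {k \<in> {1..n}. p dvd k}"
      then obtain j where "k = p * j" "1 \<le> k" "k \<le> n"
        by auto
      then have "j \<in> {1..m}"
        using p by (cases j) (auto simp: m_def less_eq_div_iff_mult_less_eq mult.commute)
      with \<open>k = p * j\<close> show "k \<in> (\<lambda>j. p * j) ` {1..m}"
        by blast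
    next
      fix k assume "k \<in> (\<lambda>j. p * j) ` {1..m}"
      then obtain j where "k = p * j" "1 \<le> j" "j \<le> m"
        by (metis atLeastAtMost_iff imageE)
      then show "k \<in> {k \<in> {1..n}. p dvd k}"
        using p order_trans[OF mult_le_mono2 m(2), of j] by auto
    qed
    have "vabs (fact n) = (\<Prod>k\<in>{1..n}. vabs (of_nat k))"
      by (simp add: fact_prod vabs_prod)
    also have "\<dots> = (\<Prod>k\<in>{k \<in> {1..n}. p dvd k}. vabs (of_nat k))"
      by (rule prod.mono_neutral_right) (auto simp: vabs_of_nat_coprime)
    also have "\<dots> = (\<Prod>j\<in>{1..m}. vabs (of_nat (p * j)))"
      unfolding multiples using p by (subst prod.reindex) (auto simp: inj_on_def)
    also have "\<dots> = (\<Prod>j\<in>{1..m}. 1 / real p * vabs (of_nat j))"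
      by (simp only: of_nat_mult vabs_mult vabs_p)
    also have "\<dots> = (1 / real p) ^ m * vabs (fact m)"
      unfolding prod.distrib by (simp add: fact_prod vabs_prod)
    finally have fact_n: "vabs (fact n) = (1 / real p) ^ m * vabs (fact m)" .
    have "conv_radius_q ^ n \<le> conv_radius_q ^ ((p - 1) * m + m)"
      using m p conv_radius_q_pos conv_radius_q_le_1
      by (intro power_decreasing) (auto simp: algebra_simps diff_mult_distrib)
    also have "\<dots> = (1 / real p) ^ m * conv_radius_q ^ m"
      by (simp only: power_add power_mult conv_radius_q_power)
    also have "\<dots> \<le> (1 / real p) ^ m * vabs (fact m)"
      by (intro mult_left_mono less.IH m) auto
    finally show ?thesis
      by (simp only: fact_n)
  qed simp
qed

section \<open>The series g\<close>

lemma vabs_add_le_1: "vabs a \<le> 1 \<Longrightarrow> vabs s < 1 \<Longrightarrow> vabs (a + s) \<le> 1"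
  by (rule vabs_add_le) auto

lemma mem_Op: "x \<in> Op \<longleftrightarrow> vabs x \<le> 1"
  unfolding Op_def mem_cball_vabs by simp

lemma mem_Bq: "q \<in> Bq p \<longleftrightarrow> vabs (q - 1) < conv_radius_q"
  unfolding Bq_def mem_ball_vabs conv_radius_q_def ..

lemma A_coeff_Suc: "A_coeff (Suc n) x = A_coeff n x * (x - of_nat (n + 2))"
  by (simp add: A_coeff_def)

lemma powser_bdd_A_coeff:
  assumes "vabs a \<le> 1"
  shows "powser_bdd 1 1 (\<lambda>s. A_coeff n (a + s))"
proof (induction n)
  case 0
  then show ?case
    by (simp add: A_coeff_def powser_bdd_const)
next
  case (Suc n)
  have "powser_bdd 1 1 (\<lambda>s. (a - of_nat (n + 2)) + s)"
    using assms by (intro powser_bdd_add powser_bdd_const powser_bdd_id vabs_diff_le vabs_of_nat_le) auto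
  from powser_bdd_mult[OF Suc this] show ?case
    by (simp add: A_coeff_Suc algebra_simps)
qed

definition g_coeff :: "nat \<Rightarrow> 'a \<Rightarrow> 'a" where
  "g_coeff n x = A_coeff n x / fact (n + 2)"

lemma powser_bdd_g_coeff:
  assumes "vabs a \<le> 1"
  shows "powser_bdd 1 (1 / conv_radius_q\<^sup>2 / conv_radius_q ^ n) (\<lambda>s. g_coeff n (a + s))"
proof -
  have "0 < vabs (fact (n + 2))"
    by (simp only: vabs_pos fact_nonzero not_False_eq_True)
  then have "vabs (1 / fact (n + 2)) * 1 \<le> 1 / conv_radius_q ^ (n + 2)"
    using vabs_fact_ge[of "n + 2"] conv_radius_q_pos unfolding vabs_divide vabs_one mult_1_right
    by (intro divide_left_mono mult_pos_pos zero_less_power) (assumption | simp)+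
  also have "\<dots> = 1 / conv_radius_q\<^sup>2 / conv_radius_q ^ n"
    by (simp add: power2_eq_square)
  finally show ?thesis
    using powser_bdd_cmult[OF powser_bdd_A_coeff[OF assms]] by (fastforce simp: g_coeff_def)
qed

lemma g_coeff_bound:
  assumes "vabs x \<le> 1"
  shows "vabs (g_coeff n x * u ^ n) \<le> 1 / conv_radius_q\<^sup>2 * (vabs u / conv_radius_q) ^ n"
proof -
  have "vabs (g_coeff n x) * vabs u ^ n \<le> (1 / conv_radius_q\<^sup>2 / conv_radius_q ^ n) * vabs u ^ n"
    using powser_bdd_value_le[OF powser_bdd_g_coeff[OF assms], of 0 n] by (intro mult_right_mono) auto
  then show ?thesis
    by (simp add: vabs_mult vabs_power power_divide)
qed

lemma summable_g_terms:
  assumes "vabs x \<le> 1" "vabs u < conv_radius_q" and w: "\<And>n. vabs (w n) \<le> 1"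
  shows "summable (\<lambda>n. w n * (g_coeff n x * u ^ n))"
proof (rule summable_if_vabs_le)
  have "vabs (w n) * vabs (g_coeff n x * u ^ n) \<le> 1 * vabs (g_coeff n x * u ^ n)" for n
    by (intro mult_right_mono w) simp
  then have "vabs (w n) * vabs (g_coeff n x * u ^ n) \<le> vabs (g_coeff n x * u ^ n)" for n
    by simp
  from order_trans[OF this g_coeff_bound[OF assms(1)]]
  show "vabs (w n * (g_coeff n x * u ^ n)) \<le> 1 / conv_radius_q\<^sup>2 * (vabs u / conv_radius_q) ^ n" for n
    unfolding vabs_mult[of "w n"] .
  show "(\<lambda>n. 1 / conv_radius_q\<^sup>2 * (vabs u / conv_radius_q) ^ n) \<longlonglongrightarrow> 0"
    using assms(2) conv_radius_q_pos
    by (intro tendsto_mult_right_zero LIMSEQ_realpow_zero) auto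
qed

lemma g_fun_sums:
  assumes "vabs x \<le> 1" "vabs (q - 1) < conv_radius_q"
  shows "(\<lambda>n. g_coeff n x * (q - 1) ^ n) sums g_fun x q"
  using summable_sums[OF summable_g_terms[OF assms, of "\<lambda>_. 1"]]
  by (simp add: g_fun_def g_coeff_def)

text \<open>
  The differential equation \<open>(1 + u) (2 g + u \<partial>g/\<partial>u) = x u g + 1\<close> in terms of series. The terms
  \<open>w\<^sub>n = (n + 2) c\<^sub>n u\<^sup>n\<close> of \<open>2 g + u \<partial>g/\<partial>u\<close> satisfy \<open>w\<^sub>0 = 1\<close> and \<open>w\<^sub>n\<^sub>+\<^sub>1 = u (x c\<^sub>n u\<^sup>n - w\<^sub>n)\<close>. If \<open>g = 0\<close>,
  summation yields \<open>e = 1 - u e\<close> for \<open>e = u \<partial>g/\<partial>u\<close>, whence \<open>e \<noteq> 0\<close>, \<open>u \<noteq> 0\<close> and \<open>\<partial>g/\<partial>u = e / u \<noteq> 0\<close>.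
\<close>

lemma g_fun_deriv_at_zero:
  assumes x: "vabs x \<le> 1" and u: "vabs u < conv_radius_q" and zero: "(\<lambda>n. g_coeff n x * u ^ n) sums 0"
  obtains d where "d \<noteq> 0" "(\<lambda>n. of_nat n * g_coeff n x * u ^ (n - 1)) sums d"
proof -
  obtain e where e: "(\<lambda>n. of_nat n * (g_coeff n x * u ^ n)) sums e"
    using summable_g_terms[of x u of_nat, OF x u vabs_of_nat_le] by (auto simp: summable_def)
  define w where "w n = of_nat (n + 2) * (g_coeff n x * u ^ n)" for n
  have "(\<lambda>n. of_nat n * (g_coeff n x * u ^ n) + 2 * (g_coeff n x * u ^ n)) sums (e + 2 * 0)"
    by (intro sums_add_vabs sums_cmult_vabs e zero)
  then have w: "w sums e"
    by (simp add: w_def[abs_def] algebra_simps)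
  have w_0: "w 0 = 1"
    by (simp add: w_def g_coeff_def A_coeff_def fact_2)
  have w_Suc: "w (Suc n) = u * (x * (g_coeff n x * u ^ n) - w n)" for n
  proof -
    have "of_nat (n + 3) * g_coeff (Suc n) x = g_coeff n x * (x - of_nat (n + 2))"
    proof -
      have "(fact (Suc n + 2) :: 'a) = of_nat (n + 3) * fact (n + 2)"
        by (simp add: eval_nat_numeral)
      moreover have "(of_nat (n + 3) :: 'a) \<noteq> 0"
        by (metis Suc3_eq_add_3 add.commute of_nat_eq_0_iff old.nat.distinct(2))
      ultimately show ?thesis
        by (simp add: g_coeff_def A_coeff_Suc del: fact_Suc of_nat_add)
    qed
    then have "w (Suc n) = g_coeff n x * (x - of_nat (n + 2)) * u ^ Suc n"
      by (simp add: w_def eval_nat_numeral mult.assoc)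
    then show ?thesis
      by (simp add: w_def algebra_simps)
  qed
  have "(\<lambda>n. w (Suc n)) sums (u * (x * 0 - e))"
    unfolding w_Suc by (intro sums_cmult_vabs sums_diff_vabs zero w)
  from sums_unique2[OF w sums_Suc_vabs[OF this]] have e_eq: "e = 1 - u * e"
    by (simp add: w_0)
  then have "e \<noteq> 0"
    by auto
  have "u \<noteq> 0"
  proof
    assume "u = 0"
    have "(\<lambda>n. of_nat n * (g_coeff n x * u ^ n)) = (\<lambda>_. 0)"
      by (auto simp: fun_eq_iff \<open>u = 0\<close> power_0_left)
    with e have "e = 0"
      using sums_unique2[OF _ sums_zero] by simp
    with \<open>e \<noteq> 0\<close> show False
      by contradiction
  qed
  show thesis
  proof (rule that)
    show "(1 / u) * e \<noteq> 0"
      using \<open>e \<noteq> 0\<close> \<open>u \<noteq> 0\<close> by simp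
    have "(1 / u) * (of_nat n * (g_coeff n x * u ^ n)) = of_nat n * g_coeff n x * u ^ (n - 1)" for n
      using \<open>u \<noteq> 0\<close> by (cases n) auto
    then show "(\<lambda>n. of_nat n * g_coeff n x * u ^ (n - 1)) sums ((1 / u) * e)"
      using sums_cmult_vabs[OF e, of "1 / u"] by simp
  qed
qed

section \<open>The nontrivial fixed points near one of them\<close>

text \<open>
  The implicit function theorem at \<open>(a, b)\<close>, in the coordinates \<open>s = x - a\<close> and \<open>u = q - 1\<close>.
\<close>

lemma M_set_locally_graph:
  fixes a b :: 'a
  assumes M: "(a, b) \<in> M_set p" and \<eta>: "0 < \<eta>"
  obtains r \<delta> c Q where "0 < r" "r \<le> \<eta>" "0 < \<delta>" "\<delta> \<le> \<eta>" "ball a r \<subseteq> Op" "ball b \<delta> \<subseteq> Bq p"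
    and "\<And>x. x \<in> ball a r \<Longrightarrow> (\<lambda>n. c n * (x - a) ^ n) sums Q x"
    and "\<And>x. x \<in> ball a r \<Longrightarrow> Q x \<in> ball b \<delta>"
    and "\<And>x y. x \<in> ball a r \<Longrightarrow> y \<in> ball b \<delta> \<Longrightarrow> (x, y) \<in> M_set p \<longleftrightarrow> y = Q x"
proof -
  have a: "vabs a \<le> 1" and b: "vabs (b - 1) < conv_radius_q" and g: "g_fun a b = 0"
    using M by (auto simp: M_set_def mem_Op mem_Bq)
  have zero: "(\<lambda>n. g_coeff n (a + 0) * (b - 1) ^ n) sums 0"
    using g_fun_sums[OF a b] g by simp
  obtain d where d: "d \<noteq> 0" "(\<lambda>n. of_nat n * g_coeff n (a + 0) * (b - 1) ^ (n - 1)) sums d"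
    using g_fun_deriv_at_zero[OF a b] zero by auto
  have "0 < min \<eta> conv_radius_q"
    using \<eta> conv_radius_q_pos by simp
  then obtain r \<delta> c t where r: "0 < r" "r \<le> min \<eta> conv_radius_q" and \<delta>: "0 < \<delta>" "\<delta> \<le> min \<eta> conv_radius_q"
    and t: "\<And>s. vabs s < r \<Longrightarrow> (\<lambda>n. c n * s ^ n) sums t s"
      "\<And>s. vabs s < r \<Longrightarrow> vabs (t s - (b - 1)) < \<delta>"
      "\<And>s u. vabs s < r \<Longrightarrow> vabs (u - (b - 1)) < \<delta> \<Longrightarrow>
        (\<lambda>n. g_coeff n (a + s) * u ^ n) sums 0 \<longleftrightarrow> u = t s"
    by (rule implicit_function_powser[OF powser_bdd_g_coeff[OF a] b zero d(2,1)]) (rule that)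
  have Op: "ball a r \<subseteq> Op"
  proof
    fix x assume "x \<in> ball a r"
    then have "vabs (x - a) < 1"
      using r conv_radius_q_le_1 unfolding mem_ball_vabs by linarith
    from vabs_add_le_1[OF a this] show "x \<in> Op"
      by (simp add: mem_Op)
  qed
  have Bq: "ball b \<delta> \<subseteq> Bq p"
    using b \<delta> unfolding Bq_def conv_radius_q_def[symmetric]
    by (intro ball_recenter) (unfold mem_ball_vabs, auto)
  define e where "e n = (if n = 0 then 1 else 0) + c n" for n
  define Q where "Q x = 1 + t (x - a)" for x
  show thesis
  proof (rule that[of r \<delta> e Q])
    fix x assume x: "x \<in> ball a r"
    then have s: "vabs (x - a) < r"
      by (simp only: mem_ball_vabs)
    have "(\<lambda>n. (if n = 0 then 1 else 0) + c n * (x - a) ^ n) sums (1 + t (x - a))"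
      by (intro sums_add_vabs sums_single t s)
    then show "(\<lambda>n. e n * (x - a) ^ n) sums Q x"
      unfolding Q_def by (rule sums_cong[THEN iffD1, rotated]) (simp add: e_def)
    show "Q x \<in> ball b \<delta>"
      using t(2)[OF s] unfolding mem_ball_vabs by (simp add: Q_def algebra_simps)
    fix y assume y: "y \<in> ball b \<delta>"
    have xy: "x \<in> Op" "y \<in> Bq p"
      using x y Op Bq by auto
    have "(x, y) \<in> M_set p \<longleftrightarrow> g_fun x y = 0"
      using xy by (simp add: M_set_def)
    also have "\<dots> \<longleftrightarrow> (\<lambda>n. g_coeff n (a + (x - a)) * (y - 1) ^ n) sums 0"
      using g_fun_sums[of x y] xy sums_unique2 unfolding mem_Op mem_Bq by auto
    also have "\<dots> \<longleftrightarrow> y - 1 = t (x - a)"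
      using y unfolding mem_ball_vabs by (intro t s) simp
    finally show "(x, y) \<in> M_set p \<longleftrightarrow> y = Q x"
      by (auto simp: Q_def algebra_simps)
  qed (use r \<delta> Op Bq in auto)
qed

text \<open>
  Around another point \<open>a'\<close> of the ball, the implicit function theorem at \<open>(a', Q a')\<close> provides a power
  series with values in \<open>ball b \<delta>\<close>. Uniqueness in \<open>ball a r \<times> ball b \<delta>\<close> identifies it with \<open>Q\<close>.
\<close>

lemma M_set_locally_analytic_graph:
  fixes a b :: 'a
  assumes M: "(a, b) \<in> M_set p"
  obtains r \<delta> Q where "0 < r" "0 < \<delta>" "ball a r \<subseteq> Op" "ball b \<delta> \<subseteq> Bq p"
    and "padic_analytic_on Q (ball a r)" "Q ` ball a r \<subseteq> ball b \<delta>"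
    and "\<And>x y. x \<in> ball a r \<Longrightarrow> y \<in> ball b \<delta> \<Longrightarrow> (x, y) \<in> M_set p \<longleftrightarrow> y = Q x"
proof -
  obtain r \<delta> Q where r: "0 < r" "ball a r \<subseteq> Op" and \<delta>: "0 < \<delta>" "ball b \<delta> \<subseteq> Bq p"
    and Q_mem: "\<And>x. x \<in> ball a r \<Longrightarrow> Q x \<in> ball b \<delta>"
    and Q_iff: "\<And>x y. x \<in> ball a r \<Longrightarrow> y \<in> ball b \<delta> \<Longrightarrow> (x, y) \<in> M_set p \<longleftrightarrow> y = Q x"
    by (rule M_set_locally_graph[OF M zero_less_one]) (rule that)
  have "padic_analytic_on Q (ball a r)"
    unfolding padic_analytic_on_def
  proof
    fix a' assume a': "a' \<in> ball a r"
    then have "(a', Q a') \<in> M_set p"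
      using Q_iff Q_mem by blast
    moreover have "0 < min r \<delta>"
      using r \<delta> by simp
    ultimately obtain r' \<delta>' c' Q' where r': "0 < r'" "r' \<le> min r \<delta>" and \<delta>': "\<delta>' \<le> min r \<delta>"
      and c': "\<And>x. x \<in> ball a' r' \<Longrightarrow> (\<lambda>n. c' n * (x - a') ^ n) sums Q' x"
      and Q'_mem: "\<And>x. x \<in> ball a' r' \<Longrightarrow> Q' x \<in> ball (Q a') \<delta>'"
      and Q'_iff: "\<And>x y. x \<in> ball a' r' \<Longrightarrow> y \<in> ball (Q a') \<delta>' \<Longrightarrow> (x, y) \<in> M_set p \<longleftrightarrow> y = Q' x"
      by (rule M_set_locally_graph) (rule that)
    have sub: "ball a' r' \<subseteq> ball a r" "ball (Q a') \<delta>' \<subseteq> ball b \<delta>"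
      using r' \<delta>' by (auto intro!: ball_recenter[OF a'] ball_recenter[OF Q_mem[OF a']] simp del: mem_ball)
    have "Q' x = Q x" if x: "x \<in> ball a' r'" for x
    proof -
      have "(x, Q' x) \<in> M_set p"
        using Q'_iff[OF x Q'_mem[OF x]] by simp
      moreover have "x \<in> ball a r" "Q' x \<in> ball b \<delta>"
        using sub x Q'_mem[OF x] by (simp_all only: subset_iff)
      ultimately show ?thesis
        using Q_iff by simp
    qed
    with c' sub r' show "\<exists>r0>0. \<exists>c. ball a' r0 \<subseteq> ball a r \<and>
        (\<forall>x\<in>ball a' r0. (\<lambda>n. c n * (x - a') ^ n) sums Q x)"
      by (intro exI[of _ r'] conjI exI[of _ c']) auto
  qed
  with r \<delta> Q_mem Q_iff show thesis
    by (intro that[of r \<delta> Q]) auto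
qed

end

theorem proposition2:
  fixes p :: nat
    and vabs :: "'a::{field_char_0, complete_space} \<Rightarrow> real"
  assumes "padic_complex_field p vabs"
  shows "padic_submanifold (M_set p :: ('a \<times> 'a) set) (Op \<times> Bq p) \<and>
    (\<forall>x q :: 'a. (x, q) \<in> M_set p \<longrightarrow>
      (\<exists>N Q. open N \<and> x \<in> N \<and> N \<subseteq> Op \<and>
        padic_analytic_on Q N \<and> Q ` N \<subseteq> Bq p \<and>
        Q x = q \<and> (\<forall>x'\<in>N. (x', Q x') \<in> M_set p)))"
proof -
  interpret padic_complex_field p vabs
    by (rule assms)
  have "padic_submanifold (M_set p :: ('a \<times> 'a) set) (Op \<times> Bq p)"
  proof (rule padic_submanifold_if_locally_graph)
    show "M_set p \<subseteq> (Op \<times> Bq p :: ('a \<times> 'a) set)"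
      by (auto simp: M_set_def)
    fix a b :: 'a assume "(a, b) \<in> M_set p"
    then obtain r \<delta> Q where "0 < r" "0 < \<delta>" "ball a r \<subseteq> Op" "ball b \<delta> \<subseteq> Bq p"
      and "padic_analytic_on Q (ball a r)" "Q ` ball a r \<subseteq> ball b \<delta>"
      and "\<And>x y. x \<in> ball a r \<Longrightarrow> y \<in> ball b \<delta> \<Longrightarrow> (x, y) \<in> M_set p \<longleftrightarrow> y = Q x"
      by (rule M_set_locally_analytic_graph) (rule that)
    then show "\<exists>r \<delta> Q. 0 < r \<and> 0 < \<delta> \<and> ball a r \<times> ball b \<delta> \<subseteq> Op \<times> Bq p \<and>
      padic_analytic_on Q (ball a r) \<and> Q ` ball a r \<subseteq> ball b \<delta> \<and>
      (\<forall>x\<in>ball a r. \<forall>y\<in>ball b \<delta>. (x, y) \<in> M_set p \<longleftrightarrow> y = Q x)"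
      by (intro exI[of _ r] exI[of _ \<delta>] exI[of _ Q] conjI Sigma_mono ballI)
  qed
  moreover have "\<exists>N Q. open N \<and> x \<in> N \<and> N \<subseteq> Op \<and> padic_analytic_on Q N \<and> Q ` N \<subseteq> Bq p \<and>
      Q x = q \<and> (\<forall>x'\<in>N. (x', Q x') \<in> M_set p)" if M: "(x, q) \<in> M_set p" for x q :: 'a
  proof -
    obtain r \<delta> Q where r: "0 < r" "0 < \<delta>"
      and sub: "ball x r \<subseteq> Op" "ball q \<delta> \<subseteq> Bq p"
      and Q: "padic_analytic_on Q (ball x r)" "Q ` ball x r \<subseteq> ball q \<delta>"
      and iff: "\<And>x' y. x' \<in> ball x r \<Longrightarrow> y \<in> ball q \<delta> \<Longrightarrow> (x', y) \<in> M_set p \<longleftrightarrow> y = Q x'"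
      by (rule M_set_locally_analytic_graph[OF M]) (rule that)
    have "Q x = q"
      using iff[of x q] M r by simp
    moreover have "\<forall>x'\<in>ball x r. (x', Q x') \<in> M_set p"
      using iff Q(2) by blast
    ultimately show ?thesis
      using r sub Q by (intro exI[of _ "ball x r"] exI[of _ Q]) auto
  qed
  ultimately show ?thesis
    by blast
qed

end
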